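(* Let $\mathbb M$ be an $\mathcal R$-module and assume that there exists an epimorphism $\pi\colon\bigoplus_{i\in I}\mathcal W_i^*\to\mathbb M$, where $\{W_i\}_{i\in I}$ is a set of $R$-modules. Then $\mathbb M$ is a left-exact $\mathcal R$-module if and only if $\mathbb M$ is a direct limit of module schemes.
   Context: $R$ is an associative ring with unit; "$R$-module" means left $R$-module. An $\mathcal R$-module is a covariant additive functor from the category of left $R$-modules to the category of abelian groups; morphisms are natural transformations. Epimorphisms, direct sums and direct limits of $\mathcal R$-modules are taken objectwise; direct limits are over upward directed sets. For an $R$-module $N$, the module scheme $\mathcal N^*$ associated with $N$ is the $\mathcal R$-module $\mathrm{Hom}_R(N,-)$. $\mathbb M$ is left-exact if it is a left-exact functor. *)

theory Defs
  imports "HOL-Algebra.Module" "HOL-Algebra.AbelCoset" "HOL-Algebra.Product_Groups"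
begin

unbundle cardinal_syntax

text \<open>
  Size conventions. HOL has no type of all left \<open>R\<close>-modules, so a universe is fixed. Its elements are
  drawn from a type \<open>'u\<close>; an \<^emph>\<open>R-module\<close> is a module whose carrier is a subset of \<open>'u\<close> of
  cardinality less than \<open>\<kappa>\<close>, and a \<^emph>\<open>set\<close> indexing a direct sum or a direct limit is one of cardinality
  less than that of \<open>'u\<close>.

  For \<open>\<kappa> = |UNIV :: 'u set|\<close> the condition below says that the cardinality of \<open>'u\<close> is a regular strong
  limit, so that both notions of smallness coincide and are those of a Grothendieck universe (which
  need not be uncountable here); this is the usual reading of the category of all left \<open>R\<close>-modules.
  Allowing a smaller \<open>\<kappa>\<close> only adds further cases. They are there because HOL proves the existence of infinite instances of them (take
  \<open>\<kappa>\<close> any infinite cardinal and \<open>'u\<close> of a sufficiently large successor cardinality), but not the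
  existence of an uncountable regular strong limit.
\<close>

definition size_setting :: "'k rel \<Rightarrow> 'u itself \<Rightarrow> bool" where
  "size_setting \<kappa> _ \<longleftrightarrow>
     Cinfinite \<kappa> \<and> regularCard |UNIV :: 'u set| \<and>
     (\<forall>A :: 'u set. |A| <o \<kappa> \<longrightarrow> |Pow A| <o |UNIV :: 'u set| )"

text \<open>
  The library locale \<open>module\<close> requires a commutative ring of scalars. Only its record type is used here;
  as there, the multiplication and the unit of the record of a module carry no meaning.
\<close>

locale left_module = R?: ring R + N?: abelian_group N
  for R :: "'r ring" (structure) and N :: "('r, 'u) module" (structure) +
  assumes smult_closed:
      "\<lbrakk>a \<in> carrier R; x \<in> carrier N\<rbrakk> \<Longrightarrow> a \<odot>\<^bsub>N\<^esub> x \<in> carrier N"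
    and smult_l_distr:
      "\<lbrakk>a \<in> carrier R; b \<in> carrier R; x \<in> carrier N\<rbrakk> \<Longrightarrow>
         (a \<oplus>\<^bsub>R\<^esub> b) \<odot>\<^bsub>N\<^esub> x = a \<odot>\<^bsub>N\<^esub> x \<oplus>\<^bsub>N\<^esub> b \<odot>\<^bsub>N\<^esub> x"
    and smult_r_distr:
      "\<lbrakk>a \<in> carrier R; x \<in> carrier N; y \<in> carrier N\<rbrakk> \<Longrightarrow>
         a \<odot>\<^bsub>N\<^esub> (x \<oplus>\<^bsub>N\<^esub> y) = a \<odot>\<^bsub>N\<^esub> x \<oplus>\<^bsub>N\<^esub> a \<odot>\<^bsub>N\<^esub> y"
    and smult_assoc:
      "\<lbrakk>a \<in> carrier R; b \<in> carrier R; x \<in> carrier N\<rbrakk> \<Longrightarrow>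
         (a \<otimes>\<^bsub>R\<^esub> b) \<odot>\<^bsub>N\<^esub> x = a \<odot>\<^bsub>N\<^esub> (b \<odot>\<^bsub>N\<^esub> x)"
    and smult_one:
      "x \<in> carrier N \<Longrightarrow> \<one>\<^bsub>R\<^esub> \<odot>\<^bsub>N\<^esub> x = x"

definition Rmod :: "'k rel \<Rightarrow> 'r ring \<Rightarrow> ('r, 'u) module set" where
  "Rmod \<kappa> R = {N. left_module R N \<and> |carrier N| <o \<kappa>}"

text \<open>Linear maps are extensional, so that equality of morphisms is equality in HOL.\<close>

definition Rhom :: "'r ring \<Rightarrow> ('r, 'u) module \<Rightarrow> ('r, 'u) module \<Rightarrow> ('u \<Rightarrow> 'u) set" where
  "Rhom R N X =
     {f \<in> carrier N \<rightarrow>\<^sub>E carrier X.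
        (\<forall>x \<in> carrier N. \<forall>y \<in> carrier N. f (x \<oplus>\<^bsub>N\<^esub> y) = f x \<oplus>\<^bsub>X\<^esub> f y) \<and>
        (\<forall>a \<in> carrier R. \<forall>x \<in> carrier N. f (a \<odot>\<^bsub>N\<^esub> x) = a \<odot>\<^bsub>X\<^esub> f x)}"

text \<open>Abelian groups are written multiplicatively, as in \<^locale>\<open>comm_group\<close>.\<close>

definition Rhom_group ::
    "'r ring \<Rightarrow> ('r, 'u) module \<Rightarrow> ('r, 'u) module \<Rightarrow> ('u \<Rightarrow> 'u) monoid" where
  "Rhom_group R N X =
     \<lparr>carrier = Rhom R N X,
      monoid.mult = (\<lambda>f g. \<lambda>x \<in> carrier N. f x \<oplus>\<^bsub>X\<^esub> g x),
      one = (\<lambda>x \<in> carrier N. \<zero>\<^bsub>X\<^esub>)\<rparr>"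

record ('r, 'u, 'a) rfunctor =
  fobj :: "('r, 'u) module \<Rightarrow> 'a monoid"
  fmor :: "('r, 'u) module \<Rightarrow> ('r, 'u) module \<Rightarrow> ('u \<Rightarrow> 'u) \<Rightarrow> 'a \<Rightarrow> 'a"

locale scriptR_module =
  fixes \<kappa> :: "'k rel" and R :: "'r ring" and F :: "('r, 'u, 'a) rfunctor"
  assumes obj: "X \<in> Rmod \<kappa> R \<Longrightarrow> comm_group (fobj F X)"
    and mor: "\<lbrakk>X \<in> Rmod \<kappa> R; Y \<in> Rmod \<kappa> R; f \<in> Rhom R X Y\<rbrakk> \<Longrightarrow>
      fmor F X Y f \<in> hom (fobj F X) (fobj F Y)"
    and ident: "\<lbrakk>X \<in> Rmod \<kappa> R; s \<in> carrier (fobj F X)\<rbrakk> \<Longrightarrow>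
      fmor F X X (\<lambda>x \<in> carrier X. x) s = s"
    and comp: "\<lbrakk>X \<in> Rmod \<kappa> R; Y \<in> Rmod \<kappa> R; Z \<in> Rmod \<kappa> R; f \<in> Rhom R X Y; g \<in> Rhom R Y Z;
        s \<in> carrier (fobj F X)\<rbrakk> \<Longrightarrow>
      fmor F X Z (compose (carrier X) g f) s = fmor F Y Z g (fmor F X Y f s)"
    and additive: "\<lbrakk>X \<in> Rmod \<kappa> R; Y \<in> Rmod \<kappa> R; f \<in> Rhom R X Y; g \<in> Rhom R X Y;
        s \<in> carrier (fobj F X)\<rbrakk> \<Longrightarrow>
      fmor F X Y (f \<otimes>\<^bsub>Rhom_group R X Y\<^esub> g) s = fmor F X Y f s \<otimes>\<^bsub>fobj F Y\<^esub> fmor F X Y g s"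

definition nat_trans ::
    "'k rel \<Rightarrow> 'r ring \<Rightarrow> ('r, 'u, 'a) rfunctor \<Rightarrow> ('r, 'u, 'b) rfunctor \<Rightarrow>
      (('r, 'u) module \<Rightarrow> 'a \<Rightarrow> 'b) \<Rightarrow> bool" where
  "nat_trans \<kappa> R F G \<theta> \<longleftrightarrow>
     (\<forall>X \<in> Rmod \<kappa> R. \<theta> X \<in> hom (fobj F X) (fobj G X)) \<and>
     (\<forall>X \<in> Rmod \<kappa> R. \<forall>Y \<in> Rmod \<kappa> R. \<forall>f \<in> Rhom R X Y. \<forall>s \<in> carrier (fobj F X).
        \<theta> Y (fmor F X Y f s) = fmor G X Y f (\<theta> X s))"

definition nat_epi ::
    "'k rel \<Rightarrow> 'r ring \<Rightarrow> ('r, 'u, 'a) rfunctor \<Rightarrow> ('r, 'u, 'b) rfunctor \<Rightarrow>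
      (('r, 'u) module \<Rightarrow> 'a \<Rightarrow> 'b) \<Rightarrow> bool" where
  "nat_epi \<kappa> R F G \<theta> \<longleftrightarrow>
     nat_trans \<kappa> R F G \<theta> \<and> (\<forall>X \<in> Rmod \<kappa> R. \<theta> X \<in> epi (fobj F X) (fobj G X))"

definition nat_iso ::
    "'k rel \<Rightarrow> 'r ring \<Rightarrow> ('r, 'u, 'a) rfunctor \<Rightarrow> ('r, 'u, 'b) rfunctor \<Rightarrow>
      (('r, 'u) module \<Rightarrow> 'a \<Rightarrow> 'b) \<Rightarrow> bool" where
  "nat_iso \<kappa> R F G \<theta> \<longleftrightarrow>
     nat_trans \<kappa> R F G \<theta> \<and> (\<forall>X \<in> Rmod \<kappa> R. \<theta> X \<in> iso (fobj F X) (fobj G X))"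

definition module_scheme :: "'r ring \<Rightarrow> ('r, 'u) module \<Rightarrow> ('r, 'u, 'u \<Rightarrow> 'u) rfunctor" where
  "module_scheme R N =
     \<lparr>fobj = Rhom_group R N,
      fmor = (\<lambda>X Y f h. compose (carrier N) f h)\<rparr>"

definition direct_sum ::
    "'i set \<Rightarrow> ('i \<Rightarrow> ('r, 'u, 'a) rfunctor) \<Rightarrow> ('r, 'u, 'i \<Rightarrow> 'a) rfunctor" where
  "direct_sum I F =
     \<lparr>fobj = (\<lambda>X. sum_group I (\<lambda>i. fobj (F i) X)),
      fmor = (\<lambda>X Y f s. \<lambda>i \<in> I. fmor (F i) X Y f (s i))\<rparr>"

definition left_exact :: "'k rel \<Rightarrow> 'r ring \<Rightarrow> ('r, 'u, 'a) rfunctor \<Rightarrow> bool" where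
  "left_exact \<kappa> R F \<longleftrightarrow>
     (\<forall>A \<in> Rmod \<kappa> R. \<forall>B \<in> Rmod \<kappa> R. \<forall>C \<in> Rmod \<kappa> R. \<forall>f \<in> Rhom R A B. \<forall>g \<in> Rhom R B C.
        inj_on f (carrier A) \<and> f ` carrier A = a_kernel B C g \<longrightarrow>
        inj_on (fmor F A B f) (carrier (fobj F A)) \<and>
        fmor F A B f ` carrier (fobj F A) = kernel (fobj F B) (fobj F C) (fmor F B C g))"

definition directed_on :: "'j set \<Rightarrow> 'j rel \<Rightarrow> bool" where
  "directed_on J r \<longleftrightarrow>
     preorder_on J r \<and> J \<noteq> {} \<and> (\<forall>j \<in> J. \<forall>k \<in> J. \<exists>l \<in> J. (j, l) \<in> r \<and> (k, l) \<in> r)"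

definition direct_system ::
    "'k rel \<Rightarrow> 'r ring \<Rightarrow> 'j set \<Rightarrow> 'j rel \<Rightarrow> ('j \<Rightarrow> ('r, 'u, 'a) rfunctor) \<Rightarrow>
      ('j \<Rightarrow> 'j \<Rightarrow> ('r, 'u) module \<Rightarrow> 'a \<Rightarrow> 'a) \<Rightarrow> bool" where
  "direct_system \<kappa> R J r F \<tau> \<longleftrightarrow>
     directed_on J r \<and>
     (\<forall>j \<in> J. scriptR_module \<kappa> R (F j)) \<and>
     (\<forall>j k. (j, k) \<in> r \<longrightarrow> nat_trans \<kappa> R (F j) (F k) (\<tau> j k)) \<and>
     (\<forall>j \<in> J. \<forall>X \<in> Rmod \<kappa> R. \<forall>s \<in> carrier (fobj (F j) X). \<tau> j j X s = s) \<and>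
     (\<forall>j k l. (j, k) \<in> r \<and> (k, l) \<in> r \<longrightarrow>
        (\<forall>X \<in> Rmod \<kappa> R. \<forall>s \<in> carrier (fobj (F j) X). \<tau> k l X (\<tau> j k X s) = \<tau> j l X s))"

text \<open>
  The direct limit of abelian groups \<open>G j\<close> with transition maps \<open>\<phi> j k\<close>: germs, that is pairs \<open>(j, s)\<close>
  with \<open>s\<close> in \<open>G j\<close>, modulo eventual equality. The operations are unions over all representatives, as
  for cosets in the library; for a direct system these unions are over equal classes.
\<close>

definition germ_rel ::
    "'j set \<Rightarrow> 'j rel \<Rightarrow> ('j \<Rightarrow> 'a monoid) \<Rightarrow> ('j \<Rightarrow> 'j \<Rightarrow> 'a \<Rightarrow> 'a) \<Rightarrow> ('j \<times> 'a) rel" where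
  "germ_rel J r G \<phi> =
     {((j, s), (k, t)). j \<in> J \<and> s \<in> carrier (G j) \<and> k \<in> J \<and> t \<in> carrier (G k) \<and>
        (\<exists>l. (j, l) \<in> r \<and> (k, l) \<in> r \<and> \<phi> j l s = \<phi> k l t)}"

definition limit_group ::
    "'j set \<Rightarrow> 'j rel \<Rightarrow> ('j \<Rightarrow> 'a monoid) \<Rightarrow> ('j \<Rightarrow> 'j \<Rightarrow> 'a \<Rightarrow> 'a) \<Rightarrow> ('j \<times> 'a) set monoid" where
  "limit_group J r G \<phi> =
     \<lparr>carrier = (SIGMA j:J. carrier (G j)) // germ_rel J r G \<phi>,
      monoid.mult = (\<lambda>A B. \<Union>(j, s) \<in> A. \<Union>(k, t) \<in> B. \<Union>l \<in> {l. (j, l) \<in> r \<and> (k, l) \<in> r}.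
        germ_rel J r G \<phi> `` {(l, \<phi> j l s \<otimes>\<^bsub>G l\<^esub> \<phi> k l t)}),
      one = (\<Union>j \<in> J. germ_rel J r G \<phi> `` {(j, \<one>\<^bsub>G j\<^esub>)})\<rparr>"

definition direct_limit ::
    "'j set \<Rightarrow> 'j rel \<Rightarrow> ('j \<Rightarrow> ('r, 'u, 'a) rfunctor) \<Rightarrow>
      ('j \<Rightarrow> 'j \<Rightarrow> ('r, 'u) module \<Rightarrow> 'a \<Rightarrow> 'a) \<Rightarrow> ('r, 'u, ('j \<times> 'a) set) rfunctor" where
  "direct_limit J r F \<tau> =
     \<lparr>fobj = (\<lambda>X. limit_group J r (\<lambda>j. fobj (F j) X) (\<lambda>j k. \<tau> j k X)),
      fmor = (\<lambda>X Y f A. \<Union>(j, s) \<in> A.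
        germ_rel J r (\<lambda>j. fobj (F j) Y) (\<lambda>j k. \<tau> j k Y) `` {(j, fmor (F j) X Y f s)})\<rparr>"

text \<open>
  Index sets are taken inside \<open>'u\<close>: every set of cardinality less than that of \<open>'u\<close> is in bijection
  with such a subset. The transition morphisms are arbitrary morphisms of functors, which by Yoneda
  are the same as linear maps \<open>N k \<Rightarrow> N j\<close> for \<open>j \<le> k\<close>.
\<close>

definition is_direct_limit_of_module_schemes ::
    "'k rel \<Rightarrow> 'r ring \<Rightarrow> ('r, 'u, 'a) rfunctor \<Rightarrow> bool" where
  "is_direct_limit_of_module_schemes \<kappa> R M \<longleftrightarrow>
     (\<exists>(J :: 'u set) r N \<tau> \<theta>.
        |J| <o |UNIV :: 'u set| \<and> (\<forall>j \<in> J. N j \<in> Rmod \<kappa> R) \<and>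
        direct_system \<kappa> R J r (\<lambda>j. module_scheme R (N j)) \<tau> \<and>
        nat_iso \<kappa> R (direct_limit J r (\<lambda>j. module_scheme R (N j)) \<tau>) M \<theta>)"

end

theory Submission
  imports Defs "HOL-Algebra.Free_Abelian_Groups"
begin

text \<open>
  Module schemes are left exact because linear maps into a kernel are the linear maps that are killed,
  and a direct limit of left exact functors is left exact because every element and every equation of
  the limit lives at some stage (\<open>left_exact_of_direct_limit\<close>).

  Conversely, let \<open>M\<close> be left exact and a quotient of the direct sum of the schemes of \<open>W i\<close>. By Yoneda, a
  morphism from the scheme of \<open>N\<close> to \<open>M\<close> is an element of \<open>M\<close> at \<open>N\<close>. For a finite set \<open>F\<close> of indices, the
  schemes of the \<open>W i\<close>, \<open>i \<in> F\<close>, have as direct sum the scheme of the module \<open>P F\<close>, the direct sum of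
  these \<open>W i\<close>, so the epimorphism restricts to an element \<open>u F\<close> of \<open>M\<close> at \<open>P F\<close>. Surjectivity says that
  every element of \<open>M\<close> at \<open>X\<close> is the image of some \<open>u F\<close> under a linear map \<open>h\<close> from \<open>P F\<close> to \<open>X\<close>.

  Relations are imposed by passing to submodules. Left exactness lets an element of \<open>M\<close> at \<open>N\<close> be
  supported on a submodule of \<open>N\<close>, in at most one way, and such supports behave like supports of
  elements of a set: they are stable under preimages and under intersections, and an element that a
  map \<open>h\<close> sends to zero is supported on the kernel of \<open>h\<close> (\<open>comes_from_preimage\<close>, \<open>comes_from_Int\<close>,
  \<open>comes_from_a_kernel_iff\<close>). The pairs \<open>(F, H)\<close> where \<open>u F\<close> is supported on the submodule \<open>H\<close> of \<open>P F\<close> are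
  therefore directed: enlarge \<open>F\<close>, pull the submodules back along the projections, and intersect. If \<open>h\<close>
  is a map on \<open>H\<close> that sends the lift of \<open>u F\<close> to zero, then the pair with \<open>H\<close> replaced by the kernel of
  \<open>h\<close> is a later index, at which \<open>h\<close> is zero. So the schemes of all these \<open>H\<close> have direct limit \<open>M\<close>
  (\<open>direct_limit_of_left_exact\<close>).

  The modules that occur have to be found inside the universe: quotients by choosing representatives,
  finite direct sums by coding pairs. The set of all pairs \<open>(F, H)\<close> is small because small modules have
  few submodules and the cardinal of the universe is regular.
\<close>

section \<open>Linear maps and submodules\<close>

lemma Rmod_left_module: "N \<in> Rmod \<kappa> R \<Longrightarrow> left_module R N"
  by (simp add: Rmod_def)

lemma RhomI:
  assumes "f \<in> carrier N \<rightarrow>\<^sub>E carrier X"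
    and "\<And>x y. \<lbrakk>x \<in> carrier N; y \<in> carrier N\<rbrakk> \<Longrightarrow> f (x \<oplus>\<^bsub>N\<^esub> y) = f x \<oplus>\<^bsub>X\<^esub> f y"
    and "\<And>a x. \<lbrakk>a \<in> carrier R; x \<in> carrier N\<rbrakk> \<Longrightarrow> f (a \<odot>\<^bsub>N\<^esub> x) = a \<odot>\<^bsub>X\<^esub> f x"
  shows "f \<in> Rhom R N X"
  using assms by (simp add: Rhom_def)

lemma Rhom_PiE: "f \<in> Rhom R N X \<Longrightarrow> f \<in> carrier N \<rightarrow>\<^sub>E carrier X"
  by (simp add: Rhom_def)

lemma Rhom_closed: "\<lbrakk>f \<in> Rhom R N X; x \<in> carrier N\<rbrakk> \<Longrightarrow> f x \<in> carrier X"
  by (auto simp: Rhom_def)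

lemma Rhom_add:
  "\<lbrakk>f \<in> Rhom R N X; x \<in> carrier N; y \<in> carrier N\<rbrakk> \<Longrightarrow> f (x \<oplus>\<^bsub>N\<^esub> y) = f x \<oplus>\<^bsub>X\<^esub> f y"
  by (simp add: Rhom_def)

lemma Rhom_smult:
  "\<lbrakk>f \<in> Rhom R N X; a \<in> carrier R; x \<in> carrier N\<rbrakk> \<Longrightarrow> f (a \<odot>\<^bsub>N\<^esub> x) = a \<odot>\<^bsub>X\<^esub> f x"
  by (simp add: Rhom_def)

lemma Rhom_eqI:
  assumes "f \<in> Rhom R N X" "g \<in> Rhom R N X" "\<And>x. x \<in> carrier N \<Longrightarrow> f x = g x"
  shows "f = g"
  using assms by (intro PiE_ext[OF Rhom_PiE Rhom_PiE])

lemma abelian_group_idem_zero: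
  assumes "abelian_group X" "x \<in> carrier X" "x \<oplus>\<^bsub>X\<^esub> x = x"
  shows "x = \<zero>\<^bsub>X\<^esub>"
proof -
  interpret abelian_group X by fact
  show ?thesis using assms add.r_cancel_one'[of x x] by metis
qed

lemma Rhom_zero:
  assumes "left_module R N" "left_module R X" "f \<in> Rhom R N X"
  shows "f \<zero>\<^bsub>N\<^esub> = \<zero>\<^bsub>X\<^esub>"
proof -
  interpret N: left_module R N by fact
  interpret X: left_module R X by fact
  have "f \<zero>\<^bsub>N\<^esub> \<oplus>\<^bsub>X\<^esub> f \<zero>\<^bsub>N\<^esub> = f \<zero>\<^bsub>N\<^esub>"
    using Rhom_add[OF assms(3), of "\<zero>\<^bsub>N\<^esub>" "\<zero>\<^bsub>N\<^esub>"] by simp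
  then show ?thesis
    by (simp add: abelian_group_idem_zero X.N.abelian_group_axioms Rhom_closed[OF assms(3)])
qed

lemma Rhom_id: "(\<lambda>x \<in> carrier N. x) \<in> Rhom R N N" if "left_module R N"
proof -
  interpret N: left_module R N by fact
  show ?thesis by (rule RhomI) (auto simp: N.smult_closed)
qed

lemma Rhom_compose:
  assumes "left_module R A" "f \<in> Rhom R A B" "g \<in> Rhom R B C"
  shows "compose (carrier A) g f \<in> Rhom R A C"
proof -
  interpret A: left_module R A by fact
  show ?thesis
    using assms(2,3)
    by (intro RhomI)
      (auto simp: compose_def Rhom_closed Rhom_add Rhom_smult A.smult_closed)
qed

lemma compose_Rhom_assoc:
  assumes "f \<in> Rhom R A B"
  shows "compose (carrier A) h (compose (carrier A) g f) = compose (carrier A) (compose (carrier B) h g) f"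
  using Rhom_closed[OF assms] by (auto simp: compose_def fun_eq_iff)

lemma compose_Rhom_id:
  "f \<in> Rhom R A B \<Longrightarrow> compose (carrier A) f (\<lambda>x \<in> carrier A. x) = f"
  "f \<in> Rhom R A B \<Longrightarrow> compose (carrier A) (\<lambda>x \<in> carrier B. x) f = f"
  by (auto simp: compose_def fun_eq_iff Rhom_def PiE_def extensional_def Pi_def)

lemma (in left_module) smult_l_zero: "x \<in> carrier N \<Longrightarrow> \<zero>\<^bsub>R\<^esub> \<odot>\<^bsub>N\<^esub> x = \<zero>\<^bsub>N\<^esub>"
  using smult_l_distr[of "\<zero>\<^bsub>R\<^esub>" "\<zero>\<^bsub>R\<^esub>" x] smult_closed[of "\<zero>\<^bsub>R\<^esub>" x]
  by (intro abelian_group_idem_zero[OF N.abelian_group_axioms]) auto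

lemma (in left_module) smult_r_zero: "a \<in> carrier R \<Longrightarrow> a \<odot>\<^bsub>N\<^esub> \<zero>\<^bsub>N\<^esub> = \<zero>\<^bsub>N\<^esub>"
  using smult_r_distr[of a "\<zero>\<^bsub>N\<^esub>" "\<zero>\<^bsub>N\<^esub>"] smult_closed[of a "\<zero>\<^bsub>N\<^esub>"]
  by (intro abelian_group_idem_zero[OF N.abelian_group_axioms]) auto

lemma (in left_module) minus_eq_smult:
  assumes "x \<in> carrier N" shows "\<ominus>\<^bsub>N\<^esub> x = (\<ominus>\<^bsub>R\<^esub> \<one>\<^bsub>R\<^esub>) \<odot>\<^bsub>N\<^esub> x"
proof -
  have "(\<ominus>\<^bsub>R\<^esub> \<one>\<^bsub>R\<^esub>) \<odot>\<^bsub>N\<^esub> x \<oplus>\<^bsub>N\<^esub> x = \<zero>\<^bsub>N\<^esub>"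
    using smult_l_distr[of "\<ominus>\<^bsub>R\<^esub> \<one>\<^bsub>R\<^esub>" "\<one>\<^bsub>R\<^esub>" x] assms
    by (simp add: smult_one smult_l_zero R.l_neg)
  then show ?thesis
    using N.minus_equality assms smult_closed by simp
qed

text \<open>
Negatives are multiples by \<open>\<ominus> \<one>\<close>, so closure under scalars takes care of them.
\<close>

lemma (in left_module) submoduleI:
  assumes "H \<subseteq> carrier N" "\<zero>\<^bsub>N\<^esub> \<in> H"
    and "\<And>x y. \<lbrakk>x \<in> H; y \<in> H\<rbrakk> \<Longrightarrow> x \<oplus>\<^bsub>N\<^esub> y \<in> H"
    and "\<And>a x. \<lbrakk>a \<in> carrier R; x \<in> H\<rbrakk> \<Longrightarrow> a \<odot>\<^bsub>N\<^esub> x \<in> H"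
  shows "submodule H R N"
proof -
  have "\<ominus>\<^bsub>N\<^esub> x \<in> H" if "x \<in> H" for x
    using that assms minus_eq_smult[of x] by auto
  with assms show ?thesis
    by (intro submodule.intro subgroup.intro submodule_axioms.intro) (auto simp flip: a_inv_def)
qed

lemma submoduleD:
  assumes "submodule H R N"
  shows "H \<subseteq> carrier N" "\<zero>\<^bsub>N\<^esub> \<in> H"
    and "\<And>x y. \<lbrakk>x \<in> H; y \<in> H\<rbrakk> \<Longrightarrow> x \<oplus>\<^bsub>N\<^esub> y \<in> H"
    and "\<And>x. x \<in> H \<Longrightarrow> \<ominus>\<^bsub>N\<^esub> x \<in> H"
    and "\<And>a x. \<lbrakk>a \<in> carrier R; x \<in> H\<rbrakk> \<Longrightarrow> a \<odot>\<^bsub>N\<^esub> x \<in> H"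
proof -
  interpret submodule H R N by fact
  show "H \<subseteq> carrier N" "\<zero>\<^bsub>N\<^esub> \<in> H"
    and "\<And>x y. \<lbrakk>x \<in> H; y \<in> H\<rbrakk> \<Longrightarrow> x \<oplus>\<^bsub>N\<^esub> y \<in> H"
    and "\<And>x. x \<in> H \<Longrightarrow> \<ominus>\<^bsub>N\<^esub> x \<in> H"
    and "\<And>a x. \<lbrakk>a \<in> carrier R; x \<in> H\<rbrakk> \<Longrightarrow> a \<odot>\<^bsub>N\<^esub> x \<in> H"
    using subset one_closed m_closed m_inv_closed smult_closed by (auto simp: a_inv_def)
qed

lemma left_module_restrict:
  assumes "left_module R N" "submodule H R N"
  shows "left_module R (N\<lparr>carrier := H\<rparr>)"
proof -
  interpret N: left_module R N by fact
  note H = submoduleD[OF assms(2)]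
  have neg: "\<exists>y\<in>H. y \<oplus>\<^bsub>N\<^esub> x = \<zero>\<^bsub>N\<^esub>" if "x \<in> H" for x
    using that H(1) H(4)[of x] N.N.l_neg by blast
  have "abelian_group (N\<lparr>carrier := H\<rparr>)"
    using H neg
    by (intro abelian_groupI) (auto simp: subset_iff N.N.a_ac)
  then show ?thesis
    using H by (intro left_module.intro left_module_axioms.intro N.R.ring_axioms)
      (auto simp: subset_iff N.smult_l_distr N.smult_r_distr N.smult_assoc N.smult_one)
qed

lemma Rmod_restrict:
  assumes "N \<in> Rmod \<kappa> R" "submodule H R N"
  shows "N\<lparr>carrier := H\<rparr> \<in> Rmod \<kappa> R"
  using assms left_module_restrict[of R N H] submoduleD(1)[OF assms(2)]
    ordLeq_ordLess_trans[OF card_of_mono1]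
  by (auto simp: Rmod_def)

lemma submodule_carrier: "left_module R N \<Longrightarrow> submodule (carrier N) R N"
proof -
  assume "left_module R N"
  then interpret N: left_module R N .
  show ?thesis by (rule N.submoduleI) (auto simp: N.smult_closed)
qed

lemma submodule_Int:
  assumes "left_module R N" "submodule H R N" "submodule K R N"
  shows "submodule (H \<inter> K) R N"
  using submoduleD[OF assms(2)] submoduleD[OF assms(3)]
  by (intro left_module.submoduleI[OF assms(1)]) auto

lemma submodule_preimage:
  assumes "left_module R N" "left_module R X" "f \<in> Rhom R N X" "submodule K R X"
  shows "submodule {x \<in> carrier N. f x \<in> K} R N"
proof -
  interpret N: left_module R N by fact
  note K = submoduleD[OF assms(4)]
  show ?thesis
    using assms(3) K Rhom_zero[OF assms(1,2,3)]
    by (intro N.submoduleI) (auto simp: N.smult_closed Rhom_add Rhom_smult)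
qed

lemma submodule_a_kernel:
  assumes "left_module R N" "left_module R X" "f \<in> Rhom R N X"
  shows "submodule (a_kernel N X f) R N"
proof -
  interpret X: left_module R X by fact
  have "submodule {\<zero>\<^bsub>X\<^esub>} R X"
    by (rule X.submoduleI) (auto simp: X.smult_r_zero)
  from submodule_preimage[OF assms this] show ?thesis
    by (simp add: a_kernel_def')
qed

lemma Rhom_restrict:
  assumes "f \<in> Rhom R N X" "submodule H R N" "f ` H \<subseteq> K"
  shows "restrict f H \<in> Rhom R (N\<lparr>carrier := H\<rparr>) (X\<lparr>carrier := K\<rparr>)"
proof -
  note H = submoduleD[OF assms(2)]
  show ?thesis
    using assms(1,3) H by (intro RhomI) (auto simp: subset_iff Rhom_add Rhom_smult)
qed

lemma Rhom_inclusion: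
  assumes "left_module R N" "submodule H R N"
  shows "(\<lambda>x \<in> H. x) \<in> Rhom R (N\<lparr>carrier := H\<rparr>) N"
  using submoduleD[OF assms(2)] by (intro RhomI) auto

section \<open>Quotient modules\<close>

text \<open>
The module structure carried along a map \<open>q\<close> out of the carrier, well defined as soon as the fibres
of \<open>q\<close> form a congruence. This is how a module with carrier inside the universe is produced: for a
quotient, \<open>q\<close> selects a representative of each coset; for a direct sum, \<open>q\<close> is an injective coding
of pairs by elements of the universe.
\<close>

definition image_module :: "('r, 'b) module \<Rightarrow> ('b \<Rightarrow> 'u) \<Rightarrow> ('r, 'u) module" where
  "image_module N q =
     \<lparr>carrier = q ` carrier N, monoid.mult = undefined, one = undefined,
      ring.zero = q \<zero>\<^bsub>N\<^esub>,
      ring.add = (\<lambda>u v. q (inv_into (carrier N) q u \<oplus>\<^bsub>N\<^esub> inv_into (carrier N) q v)),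
      smult = (\<lambda>a u. q (a \<odot>\<^bsub>N\<^esub> inv_into (carrier N) q u))\<rparr>"

definition linear_congruence :: "'r ring \<Rightarrow> ('r, 'b) module \<Rightarrow> ('b \<Rightarrow> 'u) \<Rightarrow> bool" where
  "linear_congruence R N q \<longleftrightarrow>
     (\<forall>x \<in> carrier N. \<forall>x' \<in> carrier N. \<forall>y \<in> carrier N. \<forall>y' \<in> carrier N.
        q x = q x' \<longrightarrow> q y = q y' \<longrightarrow> q (x \<oplus>\<^bsub>N\<^esub> y) = q (x' \<oplus>\<^bsub>N\<^esub> y')) \<and>
     (\<forall>a \<in> carrier R. \<forall>x \<in> carrier N. \<forall>x' \<in> carrier N.
        q x = q x' \<longrightarrow> q (a \<odot>\<^bsub>N\<^esub> x) = q (a \<odot>\<^bsub>N\<^esub> x'))"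

lemma linear_congruenceD:
  assumes "linear_congruence R N q"
  shows "\<lbrakk>x \<in> carrier N; x' \<in> carrier N; y \<in> carrier N; y' \<in> carrier N; q x = q x'; q y = q y'\<rbrakk> \<Longrightarrow>
      q (x \<oplus>\<^bsub>N\<^esub> y) = q (x' \<oplus>\<^bsub>N\<^esub> y')"
    and "\<lbrakk>a \<in> carrier R; x \<in> carrier N; x' \<in> carrier N; q x = q x'\<rbrakk> \<Longrightarrow>
      q (a \<odot>\<^bsub>N\<^esub> x) = q (a \<odot>\<^bsub>N\<^esub> x')"
  using assms unfolding linear_congruence_def by blast+

lemma carrier_image_module [simp]: "carrier (image_module N q) = q ` carrier N"
  and zero_image_module [simp]: "\<zero>\<^bsub>image_module N q\<^esub> = q \<zero>\<^bsub>N\<^esub>"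
  by (simp_all add: image_module_def)

lemma image_module_add:
  assumes "linear_congruence R N q" "x \<in> carrier N" "y \<in> carrier N"
  shows "q x \<oplus>\<^bsub>image_module N q\<^esub> q y = q (x \<oplus>\<^bsub>N\<^esub> y)"
proof -
  let ?r = "inv_into (carrier N) q"
  have "?r (q z) \<in> carrier N" "q (?r (q z)) = q z" if "z \<in> carrier N" for z
    using that by (auto intro: inv_into_into f_inv_into_f)
  then have "q (?r (q x) \<oplus>\<^bsub>N\<^esub> ?r (q y)) = q (x \<oplus>\<^bsub>N\<^esub> y)"
    using assms by (intro linear_congruenceD[OF assms(1)])
  then show ?thesis by (simp add: image_module_def)
qed

lemma image_module_smult:
  assumes "linear_congruence R N q" "a \<in> carrier R" "x \<in> carrier N"
  shows "a \<odot>\<^bsub>image_module N q\<^esub> q x = q (a \<odot>\<^bsub>N\<^esub> x)"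
proof -
  let ?r = "inv_into (carrier N) q"
  have "?r (q x) \<in> carrier N" "q (?r (q x)) = q x"
    using assms by (auto intro: inv_into_into f_inv_into_f)
  then have "q (a \<odot>\<^bsub>N\<^esub> ?r (q x)) = q (a \<odot>\<^bsub>N\<^esub> x)"
    using assms by (intro linear_congruenceD[OF assms(1)])
  then show ?thesis by (simp add: image_module_def)
qed

lemma left_module_image_module:
  assumes "left_module R N" "linear_congruence R N q"
  shows "left_module R (image_module N q)"
proof -
  interpret N: left_module R N by fact
  note [simp] = image_module_add[OF assms(2)] image_module_smult[OF assms(2)] N.smult_closed
  have "abelian_group (image_module N q)"
  proof (rule abelian_groupI)
    fix u assume "u \<in> carrier (image_module N q)"
    then obtain x where x: "x \<in> carrier N" "u = q x" by auto
    then have "q (\<ominus>\<^bsub>N\<^esub> x) \<oplus>\<^bsub>image_module N q\<^esub> u = \<zero>\<^bsub>image_module N q\<^esub>"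
      by (simp add: N.N.l_neg)
    then show "\<exists>v\<in>carrier (image_module N q). v \<oplus>\<^bsub>image_module N q\<^esub> u = \<zero>\<^bsub>image_module N q\<^esub>"
      using x by (metis N.N.a_inv_closed carrier_image_module image_eqI)
  qed (auto simp: N.N.a_ac)
  then show ?thesis
    by (intro left_module.intro left_module_axioms.intro N.R.ring_axioms)
      (auto simp: N.smult_l_distr N.smult_r_distr N.smult_assoc N.smult_one)
qed

lemma Rmod_image_module:
  assumes "left_module R N" "linear_congruence R N q" "|carrier N| <o \<kappa>"
  shows "image_module N q \<in> Rmod \<kappa> R"
  using left_module_image_module[OF assms(1,2)] ordLeq_ordLess_trans[OF card_of_image assms(3)]
  by (simp add: Rmod_def)

text \<open>
The points of the quotient are chosen representatives of the cosets of \<open>H\<close>, which keeps them in the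
universe. Every submodule is thus the kernel of a linear map between small modules, which is the form
in which left exactness can say something about it.
\<close>

lemma quotient_exists:
  assumes "N \<in> Rmod \<kappa> R" "submodule H R N"
  obtains Q q where "Q \<in> Rmod \<kappa> R" "q \<in> Rhom R N Q" "a_kernel N Q q = H"
proof -
  interpret N: left_module R N using assms(1) by (rule Rmod_left_module)
  note H = submoduleD[OF assms(2)]
  define E where "E x = {y \<in> carrier N. y \<ominus>\<^bsub>N\<^esub> x \<in> H}" for x
  define q where "q x = (SOME y. y \<in> E x)" for x
  have mem: "x \<in> E x" if "x \<in> carrier N" for x
    using that H by (simp add: E_def N.N.minus_eq N.N.r_neg)
  have diff: "E x = E y \<longleftrightarrow> x \<ominus>\<^bsub>N\<^esub> y \<in> H" if x: "x \<in> carrier N" and y: "y \<in> carrier N" for x y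
  proof
    assume "E x = E y"
    with mem[OF x] have "x \<in> E y" by simp
    then show "x \<ominus>\<^bsub>N\<^esub> y \<in> H" by (simp add: E_def)
  next
    assume xy: "x \<ominus>\<^bsub>N\<^esub> y \<in> H"
    have tri: "a \<ominus>\<^bsub>N\<^esub> b = (a \<ominus>\<^bsub>N\<^esub> c) \<oplus>\<^bsub>N\<^esub> (c \<ominus>\<^bsub>N\<^esub> b)"
      if "a \<in> carrier N" "b \<in> carrier N" "c \<in> carrier N" for a b c
      using that by (simp add: N.N.minus_eq N.N.a_assoc N.N.r_neg1)
    have yx: "y \<ominus>\<^bsub>N\<^esub> x \<in> H"
      using H(4)[OF xy] x y by (simp add: N.N.minus_eq N.N.minus_add N.N.a_comm)
    show "E x = E y"
      unfolding E_def
    proof (rule Collect_cong, rule conj_cong[OF refl])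
      fix z assume z: "z \<in> carrier N"
      show "z \<ominus>\<^bsub>N\<^esub> x \<in> H \<longleftrightarrow> z \<ominus>\<^bsub>N\<^esub> y \<in> H"
        using H(3)[OF _ xy, of "z \<ominus>\<^bsub>N\<^esub> x"] H(3)[OF _ yx, of "z \<ominus>\<^bsub>N\<^esub> y"]
          tri[OF z y x] tri[OF z x y] by metis
    qed
  qed
  have E_q: "E (q x) = E x" "q x \<in> carrier N" if x: "x \<in> carrier N" for x
  proof -
    have "q x \<in> E x" using mem[OF x] unfolding q_def by (rule someI)
    then show "q x \<in> carrier N" "E (q x) = E x" using diff x by (auto simp: E_def)
  qed
  have q_eq: "q x = q y \<longleftrightarrow> x \<ominus>\<^bsub>N\<^esub> y \<in> H" if x: "x \<in> carrier N" and y: "y \<in> carrier N" for x y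
    using diff[OF x y] E_q[OF x] E_q[OF y] by (metis q_def)
  have cong: "linear_congruence R N q"
    unfolding linear_congruence_def
  proof (intro conjI ballI impI)
    fix x x' y y'
    assume c: "x \<in> carrier N" "x' \<in> carrier N" "y \<in> carrier N" "y' \<in> carrier N"
      and "q x = q x'" "q y = q y'"
    then have "(x \<ominus>\<^bsub>N\<^esub> x') \<oplus>\<^bsub>N\<^esub> (y \<ominus>\<^bsub>N\<^esub> y') \<in> H" using H q_eq by simp
    moreover have "(x \<ominus>\<^bsub>N\<^esub> x') \<oplus>\<^bsub>N\<^esub> (y \<ominus>\<^bsub>N\<^esub> y') = (x \<oplus>\<^bsub>N\<^esub> y) \<ominus>\<^bsub>N\<^esub> (x' \<oplus>\<^bsub>N\<^esub> y')"
      using c by (simp add: N.N.minus_eq N.N.minus_add N.N.a_ac)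
    ultimately show "q (x \<oplus>\<^bsub>N\<^esub> y) = q (x' \<oplus>\<^bsub>N\<^esub> y')" using c q_eq by simp
  next
    fix a x x'
    assume c: "a \<in> carrier R" "x \<in> carrier N" "x' \<in> carrier N" and "q x = q x'"
    then have "a \<odot>\<^bsub>N\<^esub> (x \<ominus>\<^bsub>N\<^esub> x') \<in> H" using H q_eq by simp
    moreover have "a \<odot>\<^bsub>N\<^esub> (\<ominus>\<^bsub>N\<^esub> x') = \<ominus>\<^bsub>N\<^esub> (a \<odot>\<^bsub>N\<^esub> x')"
      using c N.smult_r_distr[of a "\<ominus>\<^bsub>N\<^esub> x'" x'] N.smult_closed
      by (simp add: N.N.l_neg N.smult_r_zero N.N.minus_equality)
    ultimately show "q (a \<odot>\<^bsub>N\<^esub> x) = q (a \<odot>\<^bsub>N\<^esub> x')"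
      using c q_eq by (simp add: N.N.minus_eq N.smult_r_distr N.smult_closed)
  qed
  let ?Q = "image_module N q" and ?q = "restrict q (carrier N)"
  show ?thesis
  proof
    show "?Q \<in> Rmod \<kappa> R"
      using assms(1) cong by (intro Rmod_image_module) (auto simp: Rmod_def)
    show "?q \<in> Rhom R N ?Q"
      by (rule RhomI)
        (auto simp: image_module_add[OF cong] image_module_smult[OF cong] N.smult_closed)
    show "a_kernel N ?Q ?q = H"
      using H(1) q_eq by (auto simp: a_kernel_def' N.N.minus_eq a_inv_def)
  qed
qed

section \<open>Cardinalities in the universe\<close>

lemma size_settingD:
  assumes "size_setting \<kappa> TYPE('u)"
  shows "Cinfinite \<kappa>" "regularCard |UNIV :: 'u set|"
    and "|A :: 'u set| <o \<kappa> \<Longrightarrow> |Pow A| <o |UNIV :: 'u set|"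
  using assms by (auto simp: size_setting_def)

text \<open>
Otherwise the universe would itself be a small set, so its power set would have fewer elements than
the universe, against Cantor.
\<close>

lemma size_setting_ordLeq_UNIV:
  assumes "size_setting \<kappa> TYPE('u)"
  shows "\<kappa> \<le>o |UNIV :: 'u set|"
proof (rule ccontr)
  assume "\<not> \<kappa> \<le>o |UNIV :: 'u set|"
  then have "|UNIV :: 'u set| <o \<kappa>"
    using size_settingD(1)[OF assms] card_of_Well_order
    by (metis card_order_on_well_order_on not_ordLeq_iff_ordLess)
  from size_settingD(3)[OF assms this] show False
    using card_of_Pow not_ordLess_ordLeq ordLess_imp_ordLeq by blast
qed

lemma size_setting_Cinfinite_UNIV:
  "size_setting \<kappa> TYPE('u) \<Longrightarrow> Cinfinite |UNIV :: 'u set|"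
  by (meson Cinfinite_cong Cinfinite_cprod2 cinfinite_mono card_of_Card_order
      size_settingD(1) size_setting_ordLeq_UNIV)

lemma inj_into_universe:
  assumes "|A| <o |UNIV :: 'u set|"
  obtains e :: "'b \<Rightarrow> 'u" where "inj_on e A"
  using card_of_ordLeq[of A "UNIV :: 'u set"] ordLess_imp_ordLeq[OF assms] by blast

lemma card_finite_subsets_ordLess:
  assumes "Cinfinite r" "|I| <o r"
  shows "|Fpow I| <o r"
proof (cases "finite I")
  case True
  then have "Cfinite |Fpow I|"
    by (auto simp: cfinite_def Fpow_def)
  with assms(1) show ?thesis by (intro Cfinite_ordLess_Cinfinite)
next
  case False
  then show ?thesis using assms(2) card_of_Fpow_infinite ordIso_ordLess_trans by blast
qed

section \<open>Finite coproducts of modules\<close>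

definition pair_module :: "('r, 'b) module \<Rightarrow> ('r, 'c) module \<Rightarrow> ('r, 'b \<times> 'c) module" where
  "pair_module A B =
     \<lparr>carrier = carrier A \<times> carrier B, monoid.mult = undefined, one = undefined,
      ring.zero = (\<zero>\<^bsub>A\<^esub>, \<zero>\<^bsub>B\<^esub>),
      ring.add = (\<lambda>(a, b) (a', b'). (a \<oplus>\<^bsub>A\<^esub> a', b \<oplus>\<^bsub>B\<^esub> b')),
      smult = (\<lambda>r (a, b). (r \<odot>\<^bsub>A\<^esub> a, r \<odot>\<^bsub>B\<^esub> b))\<rparr>"

lemma pair_module_simps [simp]:
  "carrier (pair_module A B) = carrier A \<times> carrier B"
  "\<zero>\<^bsub>pair_module A B\<^esub> = (\<zero>\<^bsub>A\<^esub>, \<zero>\<^bsub>B\<^esub>)"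
  "(a, b) \<oplus>\<^bsub>pair_module A B\<^esub> (a', b') = (a \<oplus>\<^bsub>A\<^esub> a', b \<oplus>\<^bsub>B\<^esub> b')"
  "r \<odot>\<^bsub>pair_module A B\<^esub> (a, b) = (r \<odot>\<^bsub>A\<^esub> a, r \<odot>\<^bsub>B\<^esub> b)"
  by (simp_all add: pair_module_def)

lemma left_module_pair_module:
  assumes "left_module R A" "left_module R B"
  shows "left_module R (pair_module A B)"
proof -
  interpret A: left_module R A by fact
  interpret B: left_module R B by fact
  have "abelian_group (pair_module A B)"
  proof (rule abelian_groupI)
    fix u assume "u \<in> carrier (pair_module A B)"
    then obtain a b where "u = (a, b)" "a \<in> carrier A" "b \<in> carrier B" by auto
    then show "\<exists>v\<in>carrier (pair_module A B). v \<oplus>\<^bsub>pair_module A B\<^esub> u = \<zero>\<^bsub>pair_module A B\<^esub>"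
      by (intro bexI[of _ "(\<ominus>\<^bsub>A\<^esub> a, \<ominus>\<^bsub>B\<^esub> b)"]) (auto simp: A.N.l_neg B.N.l_neg)
  qed (auto simp: A.N.a_ac B.N.a_ac)
  then show ?thesis
    by (intro left_module.intro left_module_axioms.intro A.R.ring_axioms)
      (auto simp: A.smult_closed A.smult_l_distr A.smult_r_distr A.smult_assoc A.smult_one
        B.smult_closed B.smult_l_distr B.smult_r_distr B.smult_assoc B.smult_one)
qed

text \<open>
A direct sum is used only through its universal property, so that the coding of its elements never
matters afterwards.
\<close>

definition coproduct ::
    "'k rel \<Rightarrow> 'r ring \<Rightarrow> 'i set \<Rightarrow> ('i \<Rightarrow> ('r, 'u) module) \<Rightarrow> ('r, 'u) module \<Rightarrow>
      ('i \<Rightarrow> 'u \<Rightarrow> 'u) \<Rightarrow> bool" where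
  "coproduct \<kappa> R F W P \<iota> \<longleftrightarrow>
     P \<in> Rmod \<kappa> R \<and> (\<forall>i \<in> F. \<iota> i \<in> Rhom R (W i) P) \<and>
     (\<forall>X \<in> Rmod \<kappa> R. \<forall>h. (\<forall>i \<in> F. h i \<in> Rhom R (W i) X) \<longrightarrow>
        (\<exists>!g. g \<in> Rhom R P X \<and> (\<forall>i \<in> F. compose (carrier (W i)) g (\<iota> i) = h i)))"

lemma coproduct_copair:
  assumes "coproduct \<kappa> R F W P \<iota>" "X \<in> Rmod \<kappa> R" "\<And>i. i \<in> F \<Longrightarrow> h i \<in> Rhom R (W i) X"
  shows "\<exists>g. g \<in> Rhom R P X \<and> (\<forall>i \<in> F. compose (carrier (W i)) g (\<iota> i) = h i)"
  using assms unfolding coproduct_def by blast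

lemma coproduct_eqI:
  assumes P: "coproduct \<kappa> R F W P \<iota>" and W: "\<And>i. i \<in> F \<Longrightarrow> left_module R (W i)" and X: "X \<in> Rmod \<kappa> R"
    and f: "f \<in> Rhom R P X" and g: "g \<in> Rhom R P X"
    and eq: "\<And>i. i \<in> F \<Longrightarrow> compose (carrier (W i)) f (\<iota> i) = compose (carrier (W i)) g (\<iota> i)"
  shows "f = g"
proof -
  let ?h = "\<lambda>i. compose (carrier (W i)) g (\<iota> i)"
  have "\<forall>i\<in>F. ?h i \<in> Rhom R (W i) X"
    using P Rhom_compose[OF W _ g] by (simp add: coproduct_def)
  then have "\<exists>!k. k \<in> Rhom R P X \<and> (\<forall>i\<in>F. compose (carrier (W i)) k (\<iota> i) = ?h i)"
    using P X by (simp add: coproduct_def)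
  then show ?thesis
    by (rule ex1E) (use f g eq in metis)
qed

text \<open>
The product set of two small carriers is small because \<open>\<kappa>\<close> is infinite, so pairs can be coded
injectively in the universe. A linear map out of the sum is determined by its two restrictions since
\<open>(a, b) = (a, \<zero>) \<oplus> (\<zero>, b)\<close>.
\<close>

lemma binary_coproduct_exists:
  fixes A B :: "('r, 'u) module"
  assumes size: "size_setting \<kappa> TYPE('u)" and A: "A \<in> Rmod \<kappa> R" and B: "B \<in> Rmod \<kappa> R"
  obtains P \<alpha> \<beta> where "P \<in> Rmod \<kappa> R" "\<alpha> \<in> Rhom R A P" "\<beta> \<in> Rhom R B P"
    and "\<And>X f g. \<lbrakk>X \<in> Rmod \<kappa> R; f \<in> Rhom R A X; g \<in> Rhom R B X\<rbrakk> \<Longrightarrow>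
      \<exists>!h. h \<in> Rhom R P X \<and> compose (carrier A) h \<alpha> = f \<and> compose (carrier B) h \<beta> = g"
proof -
  interpret A: left_module R A using A by (rule Rmod_left_module)
  interpret B: left_module R B using B by (rule Rmod_left_module)
  have small: "|carrier A \<times> carrier B| <o \<kappa>"
    using size_settingD(1)[OF size] A B
    by (auto simp: Rmod_def cinfinite_def intro!: card_of_Times_ordLess_infinite_Field)
  then obtain e :: "'u \<times> 'u \<Rightarrow> 'u" where e: "inj_on e (carrier A \<times> carrier B)"
    using inj_into_universe ordLess_ordLeq_trans[OF _ size_setting_ordLeq_UNIV[OF size]] by blast
  let ?N = "pair_module A B"
  have lm: "left_module R ?N"
    by (rule left_module_pair_module) unfold_locales
  interpret N: left_module R ?N by (rule lm)
  have cong: "linear_congruence R ?N e"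
    unfolding linear_congruence_def using inj_onD[OF e] by simp blast
  let ?P = "image_module ?N e"
  define \<alpha> where "\<alpha> = (\<lambda>a \<in> carrier A. e (a, \<zero>\<^bsub>B\<^esub>))"
  define \<beta> where "\<beta> = (\<lambda>b \<in> carrier B. e (\<zero>\<^bsub>A\<^esub>, b))"
  note add = image_module_add[OF cong] and smult = image_module_smult[OF cong]
  show ?thesis
  proof
    show "?P \<in> Rmod \<kappa> R" using small by (intro Rmod_image_module lm cong) simp
    show \<alpha>: "\<alpha> \<in> Rhom R A ?P"
      by (rule RhomI) (auto simp: \<alpha>_def add smult A.smult_closed B.smult_r_zero)
    show \<beta>: "\<beta> \<in> Rhom R B ?P"
      by (rule RhomI) (auto simp: \<beta>_def add smult B.smult_closed A.smult_r_zero)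
    fix X f g assume X: "X \<in> Rmod \<kappa> R" and f: "f \<in> Rhom R A X" and g: "g \<in> Rhom R B X"
    interpret X: left_module R X using X by (rule Rmod_left_module)
    have f0: "f \<zero>\<^bsub>A\<^esub> = \<zero>\<^bsub>X\<^esub>"
      using f by (intro Rhom_zero) unfold_locales
    have g0: "g \<zero>\<^bsub>B\<^esub> = \<zero>\<^bsub>X\<^esub>"
      using g by (intro Rhom_zero) unfold_locales
    define h where "h = (\<lambda>u \<in> carrier ?P.
      case inv_into (carrier A \<times> carrier B) e u of (a, b) \<Rightarrow> f a \<oplus>\<^bsub>X\<^esub> g b)"
    have h_e: "h (e (a, b)) = f a \<oplus>\<^bsub>X\<^esub> g b" if "a \<in> carrier A" "b \<in> carrier B" for a b
      using that e by (simp add: h_def)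
    have h: "h \<in> Rhom R ?P X"
    proof (rule RhomI)
      show "h \<in> carrier ?P \<rightarrow>\<^sub>E carrier X"
        using h_e f g by (auto simp: Rhom_closed) (simp add: h_def)
    next
      fix u v assume "u \<in> carrier ?P" "v \<in> carrier ?P"
      then obtain a b a' b' where uv: "u = e (a, b)" "v = e (a', b')"
        "a \<in> carrier A" "b \<in> carrier B" "a' \<in> carrier A" "b' \<in> carrier B" by auto
      have cl: "f a \<in> carrier X" "g b \<in> carrier X" "f a' \<in> carrier X" "g b' \<in> carrier X"
        using uv f g by (auto intro: Rhom_closed)
      show "h (u \<oplus>\<^bsub>?P\<^esub> v) = h u \<oplus>\<^bsub>X\<^esub> h v"
        using uv cl by (simp add: add h_e Rhom_add[OF f] Rhom_add[OF g] X.N.a_ac)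
    next
      fix r u assume "r \<in> carrier R" "u \<in> carrier ?P"
      then obtain a b where u: "u = e (a, b)" "a \<in> carrier A" "b \<in> carrier B" by auto
      then show "h (r \<odot>\<^bsub>?P\<^esub> u) = r \<odot>\<^bsub>X\<^esub> h u"
        using \<open>r \<in> carrier R\<close> f g
        by (simp add: smult h_e Rhom_smult[OF f] Rhom_smult[OF g] X.smult_r_distr Rhom_closed
            A.smult_closed B.smult_closed)
    qed
    show "\<exists>!h. h \<in> Rhom R ?P X \<and> compose (carrier A) h \<alpha> = f \<and> compose (carrier B) h \<beta> = g"
    proof (rule ex1I[of _ h])
      have "compose (carrier A) h \<alpha> = f"
        by (rule Rhom_eqI[OF Rhom_compose[OF _ \<alpha> h] f])
          (unfold_locales, auto simp: compose_def \<alpha>_def h_e g0 Rhom_closed[OF f])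
      moreover have "compose (carrier B) h \<beta> = g"
        by (rule Rhom_eqI[OF Rhom_compose[OF _ \<beta> h] g])
          (unfold_locales, auto simp: compose_def \<beta>_def h_e f0 Rhom_closed[OF g])
      ultimately show "h \<in> Rhom R ?P X \<and> compose (carrier A) h \<alpha> = f \<and> compose (carrier B) h \<beta> = g"
        using h by simp
    next
      fix k assume k: "k \<in> Rhom R ?P X \<and> compose (carrier A) k \<alpha> = f \<and> compose (carrier B) k \<beta> = g"
      show "k = h"
      proof (rule Rhom_eqI[OF conjunct1[OF k] h])
        fix u assume "u \<in> carrier ?P"
        then obtain a b where u: "u = e (a, b)" and ab: "a \<in> carrier A" "b \<in> carrier B" by auto
        have "u = \<alpha> a \<oplus>\<^bsub>?P\<^esub> \<beta> b"
          using ab by (simp add: u \<alpha>_def \<beta>_def add)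
        then have "k u = k (\<alpha> a) \<oplus>\<^bsub>X\<^esub> k (\<beta> b)"
          using Rhom_add[OF conjunct1[OF k]] Rhom_closed[OF \<alpha>] Rhom_closed[OF \<beta>] ab by simp
        also have "k (\<alpha> a) = f a"
          using conjunct1[OF conjunct2[OF k]] ab by (auto simp: compose_def)
        also have "k (\<beta> b) = g b"
          using conjunct2[OF conjunct2[OF k]] ab by (auto simp: compose_def)
        finally show "k u = h u" using ab by (simp add: u h_e)
      qed
    qed
  qed
qed

lemma zero_module_exists:
  assumes size: "size_setting \<kappa> TYPE('u)" and "ring R"
  obtains P :: "('r, 'u) module" where "P \<in> Rmod \<kappa> R" "carrier P = {\<zero>\<^bsub>P\<^esub>}"
proof -
  let ?P = "\<lparr>carrier = {undefined}, monoid.mult = undefined, one = undefined,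
    ring.zero = undefined, ring.add = (\<lambda>_ _. undefined), smult = (\<lambda>_ _. undefined)\<rparr> :: ('r, 'u) module"
  have "abelian_group ?P" by (rule abelian_groupI) auto
  then have "left_module R ?P"
    using assms(2) by (intro left_module.intro left_module_axioms.intro) auto
  moreover have "|carrier ?P| <o \<kappa>"
    by (rule Cfinite_ordLess_Cinfinite[OF _ size_settingD(1)[OF size]])
      (simp add: cfinite_def)
  ultimately show ?thesis by (intro that[of ?P]) (auto simp: Rmod_def)
qed

lemma finite_coproduct_exists:
  fixes W :: "'i \<Rightarrow> ('r, 'u) module"
  assumes size: "size_setting \<kappa> TYPE('u)" and "ring R" and "finite F"
    and "\<And>i. i \<in> F \<Longrightarrow> W i \<in> Rmod \<kappa> R"
  shows "\<exists>P \<iota>. coproduct \<kappa> R F W P \<iota>"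
  using assms(3,4)
proof (induction F)
  case empty
  obtain P :: "('r, 'u) module" where P: "P \<in> Rmod \<kappa> R" "carrier P = {\<zero>\<^bsub>P\<^esub>}"
    using zero_module_exists[OF size \<open>ring R\<close>] .
  interpret P: left_module R P using P(1) by (rule Rmod_left_module)
  have "\<exists>!g. g \<in> Rhom R P X" if X: "X \<in> Rmod \<kappa> R" for X :: "('r, 'u) module"
  proof (rule ex1I)
    interpret X: left_module R X using X by (rule Rmod_left_module)
    show g: "(\<lambda>x \<in> carrier P. \<zero>\<^bsub>X\<^esub>) \<in> Rhom R P X"
      by (rule RhomI) (auto simp: P.smult_closed X.smult_r_zero)
    fix k assume k: "k \<in> Rhom R P X"
    have "k \<zero>\<^bsub>P\<^esub> = \<zero>\<^bsub>X\<^esub>" using k by (intro Rhom_zero) unfold_locales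
    with P(2) show "k = (\<lambda>x \<in> carrier P. \<zero>\<^bsub>X\<^esub>)"
      by (intro Rhom_eqI[OF k g]) auto
  qed
  with P(1) have "coproduct \<kappa> R {} W P \<iota>" for \<iota> :: "'i \<Rightarrow> 'u \<Rightarrow> 'u"
    by (simp add: coproduct_def)
  then show ?case by blast
next
  case (insert j F)
  then obtain P \<iota> where P: "coproduct \<kappa> R F W P \<iota>" by blast
  then have P_Rmod: "P \<in> Rmod \<kappa> R" and \<iota>: "\<And>i. i \<in> F \<Longrightarrow> \<iota> i \<in> Rhom R (W i) P"
    by (auto simp: coproduct_def)
  have W: "W i \<in> Rmod \<kappa> R" "left_module R (W i)" if "i = j \<or> i \<in> F" for i
    using insert.prems that by (auto intro: Rmod_left_module)
  obtain Q \<alpha> \<beta> where Q: "Q \<in> Rmod \<kappa> R" and \<alpha>: "\<alpha> \<in> Rhom R P Q" and \<beta>: "\<beta> \<in> Rhom R (W j) Q"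
    and univ: "\<And>X f g. \<lbrakk>X \<in> Rmod \<kappa> R; f \<in> Rhom R P X; g \<in> Rhom R (W j) X\<rbrakk> \<Longrightarrow>
      \<exists>!h. h \<in> Rhom R Q X \<and> compose (carrier P) h \<alpha> = f \<and> compose (carrier (W j)) h \<beta> = g"
    using binary_coproduct_exists[OF size P_Rmod W(1)[of j]] by blast
  let ?\<iota> = "\<lambda>i. if i = j then \<beta> else compose (carrier (W i)) \<alpha> (\<iota> i)"
  have "coproduct \<kappa> R (insert j F) W Q ?\<iota>"
    unfolding coproduct_def
  proof (intro conjI ballI allI impI)
    show "Q \<in> Rmod \<kappa> R" by (rule Q)
    show "?\<iota> i \<in> Rhom R (W i) Q" if "i \<in> insert j F" for i
      using that \<beta> Rhom_compose[OF W(2) \<iota> \<alpha>] by auto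
    fix X h assume X: "X \<in> Rmod \<kappa> R" and h: "\<forall>i\<in>insert j F. h i \<in> Rhom R (W i) X"
    then obtain f where f: "f \<in> Rhom R P X" "\<And>i. i \<in> F \<Longrightarrow> compose (carrier (W i)) f (\<iota> i) = h i"
      and f_unique: "\<And>f'. \<lbrakk>f' \<in> Rhom R P X; \<forall>i\<in>F. compose (carrier (W i)) f' (\<iota> i) = h i\<rbrakk> \<Longrightarrow> f' = f"
      using P unfolding coproduct_def by (metis insert_iff)
    have split: "(k \<in> Rhom R Q X \<and> (\<forall>i\<in>insert j F. compose (carrier (W i)) k (?\<iota> i) = h i)) \<longleftrightarrow>
        (k \<in> Rhom R Q X \<and> compose (carrier P) k \<alpha> = f \<and> compose (carrier (W j)) k \<beta> = h j)" for k
    proof -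
      have "(\<forall>i\<in>F. compose (carrier (W i)) k (?\<iota> i) = h i) \<longleftrightarrow>
          (\<forall>i\<in>F. compose (carrier (W i)) (compose (carrier P) k \<alpha>) (\<iota> i) = h i)"
        using insert.hyps(2) by (intro ball_cong refl) (auto simp: compose_Rhom_assoc[OF \<iota>])
      moreover have "\<dots> \<longleftrightarrow> compose (carrier P) k \<alpha> = f" if "k \<in> Rhom R Q X"
        using f(2) f_unique[OF Rhom_compose[OF Rmod_left_module[OF P_Rmod] \<alpha> that]] by blast
      ultimately show ?thesis by auto
    qed
    show "\<exists>!k. k \<in> Rhom R Q X \<and> (\<forall>i\<in>insert j F. compose (carrier (W i)) k (?\<iota> i) = h i)"
      unfolding split using univ[OF X f(1), of "h j"] h by blast
  qed
  then show ?case by blast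
qed

section \<open>Direct limits as universal cocones\<close>

text \<open>
The transition structure of a direct system evaluated at one module. Inside it, \<open>germ j s\<close> is the
class of \<open>(j, s)\<close> in the direct limit.
\<close>

locale group_system =
  fixes J :: "'j set" and r :: "'j rel" and G :: "'j \<Rightarrow> 'a monoid" and \<phi> :: "'j \<Rightarrow> 'j \<Rightarrow> 'a \<Rightarrow> 'a"
  assumes directed: "directed_on J r"
    and groups: "j \<in> J \<Longrightarrow> group (G j)"
    and hom: "(j, k) \<in> r \<Longrightarrow> \<phi> j k \<in> hom (G j) (G k)"
    and trans_id: "\<lbrakk>j \<in> J; s \<in> carrier (G j)\<rbrakk> \<Longrightarrow> \<phi> j j s = s"
    and trans_comp: "\<lbrakk>(j, k) \<in> r; (k, l) \<in> r; s \<in> carrier (G j)\<rbrakk> \<Longrightarrow> \<phi> k l (\<phi> j k s) = \<phi> j l s"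
begin

abbreviation germ :: "'j \<Rightarrow> 'a \<Rightarrow> ('j \<times> 'a) set" where
  "germ j s \<equiv> germ_rel J r G \<phi> `` {(j, s)}"

abbreviation L :: "('j \<times> 'a) set monoid" where
  "L \<equiv> limit_group J r G \<phi>"

lemma le_carrier: "(j, k) \<in> r \<Longrightarrow> j \<in> J" "(j, k) \<in> r \<Longrightarrow> k \<in> J"
  and le_refl: "j \<in> J \<Longrightarrow> (j, j) \<in> r"
  and le_trans: "\<lbrakk>(j, k) \<in> r; (k, l) \<in> r\<rbrakk> \<Longrightarrow> (j, l) \<in> r"
  using directed by (auto simp: directed_on_def preorder_on_def refl_on_def dest: transD)

lemma upper_bound:
  assumes "j \<in> J" "k \<in> J"
  obtains l where "(j, l) \<in> r" "(k, l) \<in> r"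
  using assms directed by (auto simp: directed_on_def)

lemma phi_closed: "\<lbrakk>(j, k) \<in> r; s \<in> carrier (G j)\<rbrakk> \<Longrightarrow> \<phi> j k s \<in> carrier (G k)"
  by (rule hom_in_carrier[OF hom])

lemma phi_mult:
  "\<lbrakk>(j, k) \<in> r; s \<in> carrier (G j); t \<in> carrier (G j)\<rbrakk> \<Longrightarrow>
    \<phi> j k (s \<otimes>\<^bsub>G j\<^esub> t) = \<phi> j k s \<otimes>\<^bsub>G k\<^esub> \<phi> j k t"
  by (rule hom_mult[OF hom])

lemma phi_one: "(j, k) \<in> r \<Longrightarrow> \<phi> j k \<one>\<^bsub>G j\<^esub> = \<one>\<^bsub>G k\<^esub>"
  by (rule hom_one[OF hom]) (auto intro: groups le_carrier)

lemma equiv_germ_rel: "equiv (SIGMA j:J. carrier (G j)) (germ_rel J r G \<phi>)"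
proof (rule equivI)
  show "refl_on (SIGMA j:J. carrier (G j)) (germ_rel J r G \<phi>)"
    by (auto simp: refl_on_def germ_rel_def intro: le_refl)
  show "sym (germ_rel J r G \<phi>)"
    by (rule symI) (auto simp: germ_rel_def intro: sym)
  show "trans (germ_rel J r G \<phi>)"
  proof (rule transI)
    fix x y z assume xy: "(x, y) \<in> germ_rel J r G \<phi>" and yz: "(y, z) \<in> germ_rel J r G \<phi>"
    obtain j s k t i u where xyz: "x = (j, s)" "y = (k, t)" "z = (i, u)"
      by (metis surj_pair)
    obtain l where l: "(j, l) \<in> r" "(k, l) \<in> r" "\<phi> j l s = \<phi> k l t"
      and c: "s \<in> carrier (G j)" "t \<in> carrier (G k)" "j \<in> J"
      using xy by (auto simp: germ_rel_def xyz)
    obtain m where m: "(k, m) \<in> r" "(i, m) \<in> r" "\<phi> k m t = \<phi> i m u"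
      and u: "u \<in> carrier (G i)" "i \<in> J"
      using yz by (auto simp: germ_rel_def xyz)
    obtain n where n: "(l, n) \<in> r" "(m, n) \<in> r"
      using upper_bound le_carrier l m by metis
    have "\<phi> j n s = \<phi> i n u"
      using l m n c u trans_comp by metis
    moreover have "(j, n) \<in> r" "(i, n) \<in> r"
      using le_trans[OF l(1) n(1)] le_trans[OF m(2) n(2)] by auto
    ultimately show "(x, z) \<in> germ_rel J r G \<phi>"
      using c u by (auto simp: germ_rel_def xyz)
  qed
qed (auto simp: germ_rel_def)

lemma germ_eq_iff:
  assumes "j \<in> J" "s \<in> carrier (G j)" "k \<in> J" "t \<in> carrier (G k)"
  shows "germ j s = germ k t \<longleftrightarrow> (\<exists>l. (j, l) \<in> r \<and> (k, l) \<in> r \<and> \<phi> j l s = \<phi> k l t)"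
  using assms eq_equiv_class_iff[OF equiv_germ_rel, of "(j, s)" "(k, t)"]
  by (simp add: germ_rel_def)

lemma germ_eqI:
  assumes "(j, l) \<in> r" "(k, l) \<in> r" "s \<in> carrier (G j)" "t \<in> carrier (G k)" "\<phi> j l s = \<phi> k l t"
  shows "germ j s = germ k t"
  using assms le_carrier by (subst germ_eq_iff) auto

lemma mem_germ_iff:
  assumes "j \<in> J" "s \<in> carrier (G j)"
  shows "(k, t) \<in> germ j s \<longleftrightarrow> k \<in> J \<and> t \<in> carrier (G k) \<and> germ k t = germ j s"
  using assms eq_equiv_class_iff[OF equiv_germ_rel, of "(j, s)" "(k, t)"]
  by (auto simp: germ_rel_def)

lemma germ_closed: "\<lbrakk>j \<in> J; s \<in> carrier (G j)\<rbrakk> \<Longrightarrow> germ j s \<in> carrier L"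
  by (auto simp: limit_group_def intro!: quotientI)

lemma germ_cases:
  assumes "A \<in> carrier L"
  obtains j s where "j \<in> J" "s \<in> carrier (G j)" "A = germ j s"
  using assms by (auto simp: limit_group_def quotient_def)

lemma germ_phi:
  assumes "(j, k) \<in> r" "s \<in> carrier (G j)"
  shows "germ k (\<phi> j k s) = germ j s"
  using assms by (intro germ_eqI[of k k j]) (auto simp: phi_closed le_carrier le_refl trans_id)

text \<open>
The operations on germs are unions over all representatives; each of them is evaluated by checking
that the family under the union is constant.
\<close>

lemma UN_germ_eq:
  assumes "j \<in> J" "s \<in> carrier (G j)"
    and "\<And>k t. \<lbrakk>k \<in> J; t \<in> carrier (G k); germ k t = germ j s\<rbrakk> \<Longrightarrow> B k t = C"
  shows "(\<Union>(k, t) \<in> germ j s. B k t) = C"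
proof -
  have "(j, s) \<in> germ j s" using assms by (intro mem_germ_iff[THEN iffD2]) auto
  moreover have "B k t = C" if "(k, t) \<in> germ j s" for k t
    using mem_germ_iff[OF assms(1,2), THEN iffD1, OF that] assms(3) by blast
  ultimately show ?thesis by blast
qed

text \<open>
Two choices of representatives and of an upper bound give products at two stages \<open>l\<close> and \<open>l'\<close>. Beyond
both stages, and beyond the stages where the representatives become equal, the products agree.
\<close>

lemma mult_germ:
  assumes jl: "(j, l) \<in> r" and kl: "(k, l) \<in> r" and s: "s \<in> carrier (G j)" and t: "t \<in> carrier (G k)"
  shows "germ j s \<otimes>\<^bsub>L\<^esub> germ k t = germ l (\<phi> j l s \<otimes>\<^bsub>G l\<^esub> \<phi> k l t)"
proof -
  have closed: "\<phi> a l' x \<otimes>\<^bsub>G l'\<^esub> \<phi> b l' y \<in> carrier (G l')"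
    if "(a, l') \<in> r" "(b, l') \<in> r" "x \<in> carrier (G a)" "y \<in> carrier (G b)" for a b l' x y
    using that groups[OF le_carrier(2)] phi_closed by (meson group.is_monoid monoid.m_closed)
  have eq: "germ l' (\<phi> j' l' s' \<otimes>\<^bsub>G l'\<^esub> \<phi> k' l' t') = germ l (\<phi> j l s \<otimes>\<^bsub>G l\<^esub> \<phi> k l t)"
    if j': "j' \<in> J" "s' \<in> carrier (G j')" "germ j' s' = germ j s"
      and k': "k' \<in> J" "t' \<in> carrier (G k')" "germ k' t' = germ k t"
      and l': "(j', l') \<in> r" "(k', l') \<in> r" for j' s' k' t' l'
  proof -
    obtain p where p: "(j', p) \<in> r" "(j, p) \<in> r" "\<phi> j' p s' = \<phi> j p s"
      using j' le_carrier[OF jl] s by (auto simp: germ_eq_iff)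
    obtain q where q: "(k', q) \<in> r" "(k, q) \<in> r" "\<phi> k' q t' = \<phi> k q t"
      using k' le_carrier[OF kl] t by (auto simp: germ_eq_iff)
    obtain m0 where m0: "(p, m0) \<in> r" "(q, m0) \<in> r"
      using upper_bound le_carrier p q by metis
    obtain m1 where m1: "(l, m1) \<in> r" "(l', m1) \<in> r"
      using upper_bound le_carrier jl l' by metis
    obtain m where m: "(m0, m) \<in> r" "(m1, m) \<in> r"
      using upper_bound le_carrier m0 m1 by metis
    have pm: "(p, m) \<in> r" "(q, m) \<in> r" "(l, m) \<in> r" "(l', m) \<in> r"
      using m m0 m1 le_trans by blast+
    have s_eq: "\<phi> j' m s' = \<phi> j m s"
      using p pm s j' trans_comp by metis
    have t_eq: "\<phi> k' m t' = \<phi> k m t"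
      using q pm t k' trans_comp by metis
    have "\<phi> l' m (\<phi> j' l' s' \<otimes>\<^bsub>G l'\<^esub> \<phi> k' l' t') = \<phi> j' m s' \<otimes>\<^bsub>G m\<^esub> \<phi> k' m t'"
      using l' pm j' k' by (simp add: phi_mult phi_closed trans_comp)
    also have "\<dots> = \<phi> l m (\<phi> j l s \<otimes>\<^bsub>G l\<^esub> \<phi> k l t)"
      using jl kl pm s t by (simp add: phi_mult phi_closed trans_comp s_eq t_eq)
    finally show ?thesis
      using pm j' k' l' jl kl s t by (intro germ_eqI[of l' m l] closed) auto
  qed
  have inner: "(\<Union>l' \<in> {l'. (j', l') \<in> r \<and> (k', l') \<in> r}. germ l' (\<phi> j' l' s' \<otimes>\<^bsub>G l'\<^esub> \<phi> k' l' t')) =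
      germ l (\<phi> j l s \<otimes>\<^bsub>G l\<^esub> \<phi> k l t)"
    if "j' \<in> J" "s' \<in> carrier (G j')" "germ j' s' = germ j s"
      "k' \<in> J" "t' \<in> carrier (G k')" "germ k' t' = germ k t" for j' s' k' t'
  proof -
    obtain l' where "(j', l') \<in> r" "(k', l') \<in> r"
      using upper_bound \<open>j' \<in> J\<close> \<open>k' \<in> J\<close> by metis
    then show ?thesis using eq[OF that] by blast
  qed
  have "germ j s \<otimes>\<^bsub>L\<^esub> germ k t = (\<Union>(j', s') \<in> germ j s. \<Union>(k', t') \<in> germ k t.
      \<Union>l' \<in> {l'. (j', l') \<in> r \<and> (k', l') \<in> r}. germ l' (\<phi> j' l' s' \<otimes>\<^bsub>G l'\<^esub> \<phi> k' l' t'))"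
    by (simp add: limit_group_def)
  also have "\<dots> = germ l (\<phi> j l s \<otimes>\<^bsub>G l\<^esub> \<phi> k l t)"
    using le_carrier[OF jl] le_carrier[OF kl] s t inner by (intro UN_germ_eq) auto
  finally show ?thesis .
qed

lemma one_germ:
  assumes "j \<in> J"
  shows "\<one>\<^bsub>L\<^esub> = germ j \<one>\<^bsub>G j\<^esub>"
proof -
  have one: "\<one>\<^bsub>G k\<^esub> \<in> carrier (G k)" if "k \<in> J" for k
    using groups[OF that] by (simp add: group.is_monoid)
  have "germ k \<one>\<^bsub>G k\<^esub> = germ j \<one>\<^bsub>G j\<^esub>" if k: "k \<in> J" for k
  proof -
    obtain l where "(j, l) \<in> r" "(k, l) \<in> r" using upper_bound assms k by metis
    then show ?thesis
      using one assms k by (intro germ_eqI[of k l j]) (auto simp: phi_one)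
  qed
  then have "(\<Union>k \<in> J. germ k \<one>\<^bsub>G k\<^esub>) = germ j \<one>\<^bsub>G j\<^esub>"
    using assms by blast
  then show ?thesis by (simp add: limit_group_def)
qed

text \<open>
A multiplicative map into a group sends every idempotent to the unit; with this the unit of the limit
can be followed along an isomorphism onto a group.
\<close>

lemma one_L_idem: "\<one>\<^bsub>L\<^esub> \<in> carrier L" "\<one>\<^bsub>L\<^esub> \<otimes>\<^bsub>L\<^esub> \<one>\<^bsub>L\<^esub> = \<one>\<^bsub>L\<^esub>"
proof -
  obtain j where j: "j \<in> J" using directed by (auto simp: directed_on_def)
  interpret group "G j" using groups[OF j] .
  show "\<one>\<^bsub>L\<^esub> \<in> carrier L" using j by (simp add: one_germ[OF j] germ_closed)
  show "\<one>\<^bsub>L\<^esub> \<otimes>\<^bsub>L\<^esub> \<one>\<^bsub>L\<^esub> = \<one>\<^bsub>L\<^esub>"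
    using mult_germ[OF le_refl[OF j] le_refl[OF j] one_closed one_closed]
    by (simp add: one_germ[OF j] trans_id j)
qed

end

lemma direct_systemD:
  assumes "direct_system \<kappa> R J r F \<tau>"
  shows "directed_on J r"
    and "j \<in> J \<Longrightarrow> scriptR_module \<kappa> R (F j)"
    and "(j, k) \<in> r \<Longrightarrow> nat_trans \<kappa> R (F j) (F k) (\<tau> j k)"
    and "\<lbrakk>j \<in> J; X \<in> Rmod \<kappa> R; s \<in> carrier (fobj (F j) X)\<rbrakk> \<Longrightarrow> \<tau> j j X s = s"
    and "\<lbrakk>(j, k) \<in> r; (k, l) \<in> r; X \<in> Rmod \<kappa> R; s \<in> carrier (fobj (F j) X)\<rbrakk> \<Longrightarrow>
      \<tau> k l X (\<tau> j k X s) = \<tau> j l X s"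
  using assms by (auto simp: direct_system_def)

lemma nat_transD:
  assumes "nat_trans \<kappa> R F G \<theta>"
  shows "X \<in> Rmod \<kappa> R \<Longrightarrow> \<theta> X \<in> hom (fobj F X) (fobj G X)"
    and "\<lbrakk>X \<in> Rmod \<kappa> R; s \<in> carrier (fobj F X)\<rbrakk> \<Longrightarrow> \<theta> X s \<in> carrier (fobj G X)"
    and "\<lbrakk>X \<in> Rmod \<kappa> R; Y \<in> Rmod \<kappa> R; f \<in> Rhom R X Y; s \<in> carrier (fobj F X)\<rbrakk> \<Longrightarrow>
      \<theta> Y (fmor F X Y f s) = fmor G X Y f (\<theta> X s)"
  using assms by (auto simp: nat_trans_def intro: hom_in_carrier)

lemma scriptR_module_group: "\<lbrakk>scriptR_module \<kappa> R F; X \<in> Rmod \<kappa> R\<rbrakk> \<Longrightarrow> group (fobj F X)"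
  by (simp add: comm_group.axioms(2) scriptR_module.obj)

lemma scriptR_module_closed:
  "\<lbrakk>scriptR_module \<kappa> R F; X \<in> Rmod \<kappa> R; Y \<in> Rmod \<kappa> R; f \<in> Rhom R X Y; s \<in> carrier (fobj F X)\<rbrakk> \<Longrightarrow>
    fmor F X Y f s \<in> carrier (fobj F Y)"
  by (rule hom_in_carrier[OF scriptR_module.mor])

lemma group_system_direct_system:
  assumes sys: "direct_system \<kappa> R J r F \<tau>" and X: "X \<in> Rmod \<kappa> R"
  shows "group_system J r (\<lambda>j. fobj (F j) X) (\<lambda>j k. \<tau> j k X)"
  using X scriptR_module_group[OF direct_systemD(2)[OF sys] X]
  by (intro group_system.intro)
    (simp_all add: direct_systemD[OF sys] nat_transD(1)[OF direct_systemD(3)[OF sys]])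

text \<open>
The elementwise form of the statement that \<open>\<sigma>\<close> exhibits \<open>M\<close> as a direct limit: the \<open>\<sigma> j\<close> are compatible
and jointly surjective, and an element that dies in \<open>M\<close> already dies at a later stage. The two lemmas
\<open>limit_cocone_of_nat_iso\<close> and \<open>nat_iso_of_limit_cocone\<close> relate it to the construction by germs;
all further reasoning about direct limits happens in this form.
\<close>

definition limit_cocone ::
    "'k rel \<Rightarrow> 'r ring \<Rightarrow> 'j set \<Rightarrow> 'j rel \<Rightarrow> ('j \<Rightarrow> ('r, 'u, 'a) rfunctor) \<Rightarrow>
      ('j \<Rightarrow> 'j \<Rightarrow> ('r, 'u) module \<Rightarrow> 'a \<Rightarrow> 'a) \<Rightarrow> ('r, 'u, 'b) rfunctor \<Rightarrow>
      ('j \<Rightarrow> ('r, 'u) module \<Rightarrow> 'a \<Rightarrow> 'b) \<Rightarrow> bool" where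
  "limit_cocone \<kappa> R J r F \<tau> M \<sigma> \<longleftrightarrow>
     (\<forall>j \<in> J. nat_trans \<kappa> R (F j) M (\<sigma> j)) \<and>
     (\<forall>j k. (j, k) \<in> r \<longrightarrow> (\<forall>X \<in> Rmod \<kappa> R. \<forall>s \<in> carrier (fobj (F j) X).
        \<sigma> k X (\<tau> j k X s) = \<sigma> j X s)) \<and>
     (\<forall>X \<in> Rmod \<kappa> R. \<forall>t \<in> carrier (fobj M X). \<exists>j \<in> J. \<exists>s \<in> carrier (fobj (F j) X). t = \<sigma> j X s) \<and>
     (\<forall>X \<in> Rmod \<kappa> R. \<forall>j \<in> J. \<forall>s \<in> carrier (fobj (F j) X). \<sigma> j X s = \<one>\<^bsub>fobj M X\<^esub> \<longrightarrow>
        (\<exists>k. (j, k) \<in> r \<and> \<tau> j k X s = \<one>\<^bsub>fobj (F k) X\<^esub>))"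

lemma limit_coconeD:
  assumes "limit_cocone \<kappa> R J r F \<tau> M \<sigma>"
  shows "j \<in> J \<Longrightarrow> nat_trans \<kappa> R (F j) M (\<sigma> j)"
    and "\<lbrakk>(j, k) \<in> r; X \<in> Rmod \<kappa> R; s \<in> carrier (fobj (F j) X)\<rbrakk> \<Longrightarrow> \<sigma> k X (\<tau> j k X s) = \<sigma> j X s"
    and "\<lbrakk>X \<in> Rmod \<kappa> R; t \<in> carrier (fobj M X)\<rbrakk> \<Longrightarrow>
      \<exists>j \<in> J. \<exists>s \<in> carrier (fobj (F j) X). t = \<sigma> j X s"
    and "\<lbrakk>X \<in> Rmod \<kappa> R; j \<in> J; s \<in> carrier (fobj (F j) X); \<sigma> j X s = \<one>\<^bsub>fobj M X\<^esub>\<rbrakk> \<Longrightarrow>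
      \<exists>k. (j, k) \<in> r \<and> \<tau> j k X s = \<one>\<^bsub>fobj (F k) X\<^esub>"
  using assms unfolding limit_cocone_def by blast+

lemma fobj_direct_limit [simp]:
  "fobj (direct_limit J r F \<tau>) X = limit_group J r (\<lambda>j. fobj (F j) X) (\<lambda>j k. \<tau> j k X)"
  by (simp add: direct_limit_def)

text \<open>
Naturality of the transition morphisms makes the germ of the image independent of the representative.
\<close>

lemma fmor_direct_limit_germ:
  assumes sys: "direct_system \<kappa> R J r F \<tau>" and X: "X \<in> Rmod \<kappa> R" and Y: "Y \<in> Rmod \<kappa> R"
    and f: "f \<in> Rhom R X Y" and j: "j \<in> J" and s: "s \<in> carrier (fobj (F j) X)"
  shows "fmor (direct_limit J r F \<tau>) X Y f
      (germ_rel J r (\<lambda>j. fobj (F j) X) (\<lambda>j k. \<tau> j k X) `` {(j, s)}) =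
    germ_rel J r (\<lambda>j. fobj (F j) Y) (\<lambda>j k. \<tau> j k Y) `` {(j, fmor (F j) X Y f s)}"
proof -
  interpret X: group_system J r "\<lambda>j. fobj (F j) X" "\<lambda>j k. \<tau> j k X"
    by (rule group_system_direct_system[OF sys X])
  interpret Y: group_system J r "\<lambda>j. fobj (F j) Y" "\<lambda>j k. \<tau> j k Y"
    by (rule group_system_direct_system[OF sys Y])
  note closed = scriptR_module_closed[OF direct_systemD(2)[OF sys] X Y f]
  have "Y.germ k (fmor (F k) X Y f t) = Y.germ j (fmor (F j) X Y f s)"
    if k: "k \<in> J" and t: "t \<in> carrier (fobj (F k) X)" and eq: "X.germ k t = X.germ j s" for k t
  proof -
    obtain l where l: "(k, l) \<in> r" "(j, l) \<in> r" "\<tau> k l X t = \<tau> j l X s"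
      using eq k t j s by (auto simp: X.germ_eq_iff)
    have "\<tau> k l Y (fmor (F k) X Y f t) = \<tau> j l Y (fmor (F j) X Y f s)"
      using nat_transD(3)[OF direct_systemD(3)[OF sys l(1)] X Y f t]
        nat_transD(3)[OF direct_systemD(3)[OF sys l(2)] X Y f s] l(3) by simp
    with l k j s t show ?thesis by (intro Y.germ_eqI[of k l j]) (auto intro: closed)
  qed
  then have "(\<Union>(k, t) \<in> X.germ j s. Y.germ k (fmor (F k) X Y f t)) = Y.germ j (fmor (F j) X Y f s)"
    by (rule X.UN_germ_eq[OF j s])
  then show ?thesis by (simp only: direct_limit_def rfunctor.simps)
qed

lemma limit_cocone_of_nat_iso:
  fixes F :: "'j \<Rightarrow> ('r, 'u, 'a) rfunctor"
  assumes sys: "direct_system \<kappa> R J r F \<tau>" and M: "scriptR_module \<kappa> R M"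
    and iso: "nat_iso \<kappa> R (direct_limit J r F \<tau>) M \<theta>"
  shows "limit_cocone \<kappa> R J r F \<tau> M
    (\<lambda>j X s. \<theta> X (germ_rel J r (\<lambda>j. fobj (F j) X) (\<lambda>j k. \<tau> j k X) `` {(j, s)}))"
  (is "limit_cocone \<kappa> R J r F \<tau> M ?\<sigma>")
proof -
  have gs: "group_system J r (\<lambda>j. fobj (F j) X) (\<lambda>j k. \<tau> j k X)" if "X \<in> Rmod \<kappa> R" for X :: "('r, 'u) module"
    by (rule group_system_direct_system[OF sys that])
  note nat = nat_transD[OF conjunct1[OF iso[unfolded nat_iso_def]]]
  have bij: "bij_betw (\<theta> X) (carrier (fobj (direct_limit J r F \<tau>) X)) (carrier (fobj M X))"
    if "X \<in> Rmod \<kappa> R" for X :: "('r, 'u) module"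
    using iso that by (auto simp: nat_iso_def iso_def)
  show ?thesis
    unfolding limit_cocone_def
  proof (intro conjI ballI allI impI)
    fix j assume j: "j \<in> J"
    show "nat_trans \<kappa> R (F j) M (?\<sigma> j)"
      unfolding nat_trans_def
    proof (intro conjI ballI)
      fix X :: "('r, 'u) module" assume X: "X \<in> Rmod \<kappa> R"
      interpret X: group_system J r "\<lambda>j. fobj (F j) X" "\<lambda>j k. \<tau> j k X" by (rule gs[OF X])
      interpret Fj: group "fobj (F j) X" by (rule X.groups[OF j])
      show "?\<sigma> j X \<in> hom (fobj (F j) X) (fobj M X)"
      proof (rule homI)
        fix s assume "s \<in> carrier (fobj (F j) X)"
        then show "?\<sigma> j X s \<in> carrier (fobj M X)"
          using nat(2)[OF X] X.germ_closed[OF j] by simp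
      next
        fix s t assume st: "s \<in> carrier (fobj (F j) X)" "t \<in> carrier (fobj (F j) X)"
        have "X.germ j (s \<otimes>\<^bsub>fobj (F j) X\<^esub> t) = X.germ j s \<otimes>\<^bsub>X.L\<^esub> X.germ j t"
          using X.mult_germ[OF X.le_refl[OF j] X.le_refl[OF j] st] st j by (simp add: X.trans_id)
        then show "?\<sigma> j X (s \<otimes>\<^bsub>fobj (F j) X\<^esub> t) = ?\<sigma> j X s \<otimes>\<^bsub>fobj M X\<^esub> ?\<sigma> j X t"
          using hom_mult[OF nat(1)[OF X]] st X.germ_closed[OF j] by simp
      qed
      fix Y f s assume Y: "Y \<in> Rmod \<kappa> R" and f: "f \<in> Rhom R X Y" and s: "s \<in> carrier (fobj (F j) X)"
      show "?\<sigma> j Y (fmor (F j) X Y f s) = fmor M X Y f (?\<sigma> j X s)"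
        using nat(3)[OF X Y f, of "X.germ j s"] X.germ_closed[OF j s] fmor_direct_limit_germ[OF sys X Y f j s] by simp
    qed
  next
    fix j k X s assume jk: "(j, k) \<in> r" and X: "X \<in> Rmod \<kappa> R" and s: "s \<in> carrier (fobj (F j) X)"
    show "?\<sigma> k X (\<tau> j k X s) = ?\<sigma> j X s"
      using group_system.germ_phi[OF gs[OF X] jk s] by simp
  next
    fix X t assume X: "X \<in> Rmod \<kappa> R" and t: "t \<in> carrier (fobj M X)"
    then obtain A where "A \<in> carrier (fobj (direct_limit J r F \<tau>) X)" "t = \<theta> X A"
      using bij[OF X] by (auto simp: bij_betw_def)
    then show "\<exists>j\<in>J. \<exists>s\<in>carrier (fobj (F j) X). t = ?\<sigma> j X s"
      using group_system.germ_cases[OF gs[OF X]] by (metis fobj_direct_limit)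
  next
    fix X j s assume X: "X \<in> Rmod \<kappa> R" and j: "j \<in> J" and s: "s \<in> carrier (fobj (F j) X)"
      and eq: "?\<sigma> j X s = \<one>\<^bsub>fobj M X\<^esub>"
    interpret X: group_system J r "\<lambda>j. fobj (F j) X" "\<lambda>j k. \<tau> j k X" by (rule gs[OF X])
    interpret Fj: group "fobj (F j) X" by (rule X.groups[OF j])
    interpret MX: group "fobj M X" by (rule scriptR_module_group[OF M X])
    \<comment> \<open>The image of the idempotent unit of the limit is an idempotent of a group.\<close>
    have "\<theta> X \<one>\<^bsub>X.L\<^esub> = \<one>\<^bsub>fobj M X\<^esub>"
      using hom_mult[OF nat(1)[OF X], of "\<one>\<^bsub>X.L\<^esub>" "\<one>\<^bsub>X.L\<^esub>"] nat(2)[OF X, of "\<one>\<^bsub>X.L\<^esub>"] X.one_L_idem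
      by (metis MX.l_cancel_one' fobj_direct_limit)
    then have "X.germ j s = \<one>\<^bsub>X.L\<^esub>"
      using bij[OF X] eq X.germ_closed[OF j s] X.one_L_idem(1)
      by (metis bij_betw_def fobj_direct_limit inj_onD)
    then obtain k where "(j, k) \<in> r" "\<tau> j k X s = \<tau> j k X \<one>\<^bsub>fobj (F j) X\<^esub>"
      using j s by (auto simp: X.one_germ[OF j] X.germ_eq_iff)
    then show "\<exists>k. (j, k) \<in> r \<and> \<tau> j k X s = \<one>\<^bsub>fobj (F k) X\<^esub>"
      using X.phi_one by auto
  qed
qed

text \<open>
The map sends the germ of \<open>s\<close> at \<open>j\<close> to \<open>\<sigma> j s\<close>. For injectivity, two germs are moved to a common
stage, where the quotient of their representatives has trivial image and hence dies later on.
\<close>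

lemma nat_iso_of_limit_cocone:
  fixes F :: "'j \<Rightarrow> ('r, 'u, 'a) rfunctor"
  assumes sys: "direct_system \<kappa> R J r F \<tau>" and M: "scriptR_module \<kappa> R M"
    and cocone: "limit_cocone \<kappa> R J r F \<tau> M \<sigma>"
  shows "\<exists>\<theta>. nat_iso \<kappa> R (direct_limit J r F \<tau>) M \<theta>"
proof -
  define \<theta> where "\<theta> X A = (case SOME p. p \<in> A of (j, s) \<Rightarrow> \<sigma> j X s)" for X A
  note C = limit_coconeD[OF cocone]
  have gs: "group_system J r (\<lambda>j. fobj (F j) X) (\<lambda>j k. \<tau> j k X)" if "X \<in> Rmod \<kappa> R" for X :: "('r, 'u) module"
    by (rule group_system_direct_system[OF sys that])
  note closed = nat_transD(2)[OF C(1)]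
  have \<theta>_germ: "\<theta> X (germ_rel J r (\<lambda>j. fobj (F j) X) (\<lambda>j k. \<tau> j k X) `` {(j, s)}) = \<sigma> j X s"
    if X: "X \<in> Rmod \<kappa> R" and j: "j \<in> J" and s: "s \<in> carrier (fobj (F j) X)" for X j s
  proof -
    interpret X: group_system J r "\<lambda>j. fobj (F j) X" "\<lambda>j k. \<tau> j k X" by (rule gs[OF X])
    obtain k t where kt: "(SOME p. p \<in> X.germ j s) = (k, t)" by (metis surj_pair)
    have "(j, s) \<in> X.germ j s" using j s by (intro X.mem_germ_iff[THEN iffD2]) auto
    then have "(k, t) \<in> X.germ j s" unfolding kt[symmetric] by (rule someI)
    then have k: "k \<in> J" and t: "t \<in> carrier (fobj (F k) X)" and eq: "X.germ k t = X.germ j s"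
      using X.mem_germ_iff[OF j s, of k t] by blast+
    then obtain l where "(k, l) \<in> r" "(j, l) \<in> r" "\<tau> k l X t = \<tau> j l X s"
      using j s by (auto simp: X.germ_eq_iff)
    then have "\<sigma> k X t = \<sigma> j X s"
      using C(2)[OF _ X] s t by metis
    then show ?thesis unfolding \<theta>_def kt by simp
  qed
  have "nat_iso \<kappa> R (direct_limit J r F \<tau>) M \<theta>"
    unfolding nat_iso_def nat_trans_def
  proof (intro conjI ballI)
    fix X :: "('r, 'u) module" assume X: "X \<in> Rmod \<kappa> R"
    interpret X: group_system J r "\<lambda>j. fobj (F j) X" "\<lambda>j k. \<tau> j k X" by (rule gs[OF X])
    interpret MX: group "fobj M X" by (rule scriptR_module_group[OF M X])
    show hom: "\<theta> X \<in> hom (fobj (direct_limit J r F \<tau>) X) (fobj M X)"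
    proof (rule homI)
      fix A assume "A \<in> carrier (fobj (direct_limit J r F \<tau>) X)"
      then show "\<theta> X A \<in> carrier (fobj M X)"
        by (auto elim!: X.germ_cases simp: \<theta>_germ[OF X] closed[OF _ X])
    next
      fix A B assume "A \<in> carrier (fobj (direct_limit J r F \<tau>) X)" "B \<in> carrier (fobj (direct_limit J r F \<tau>) X)"
      then obtain j s k t where j: "j \<in> J" "s \<in> carrier (fobj (F j) X)" "A = X.germ j s"
        and k: "k \<in> J" "t \<in> carrier (fobj (F k) X)" "B = X.germ k t"
        by (auto elim!: X.germ_cases)
      obtain l where l: "(j, l) \<in> r" "(k, l) \<in> r" using X.upper_bound j k by metis
      then have lJ: "l \<in> J" using X.le_carrier by blast
      interpret Fl: group "fobj (F l) X" by (rule X.groups[OF lJ])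
      have "\<theta> X (A \<otimes>\<^bsub>X.L\<^esub> B) = \<sigma> l X (\<tau> j l X s \<otimes>\<^bsub>fobj (F l) X\<^esub> \<tau> k l X t)"
        using X.mult_germ[OF l j(2) k(2)] X.phi_closed[OF l(1) j(2)] X.phi_closed[OF l(2) k(2)] lJ
        by (simp add: j k \<theta>_germ[OF X])
      also have "\<dots> = \<sigma> l X (\<tau> j l X s) \<otimes>\<^bsub>fobj M X\<^esub> \<sigma> l X (\<tau> k l X t)"
        using X.phi_closed[OF l(1) j(2)] X.phi_closed[OF l(2) k(2)]
        by (rule hom_mult[OF nat_transD(1)[OF C(1)[OF lJ] X]])
      also have "\<dots> = \<theta> X A \<otimes>\<^bsub>fobj M X\<^esub> \<theta> X B"
        using j k by (simp add: C(2)[OF l(1) X] C(2)[OF l(2) X] \<theta>_germ[OF X])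
      finally show "\<theta> X (A \<otimes>\<^bsub>fobj (direct_limit J r F \<tau>) X\<^esub> B) = \<theta> X A \<otimes>\<^bsub>fobj M X\<^esub> \<theta> X B"
        by simp
    qed
    have "inj_on (\<theta> X) (carrier X.L)"
    proof (rule inj_onI)
      fix A B assume "A \<in> carrier X.L" "B \<in> carrier X.L" and eq: "\<theta> X A = \<theta> X B"
      then obtain j s k t where j: "j \<in> J" "s \<in> carrier (fobj (F j) X)" "A = X.germ j s"
        and k: "k \<in> J" "t \<in> carrier (fobj (F k) X)" "B = X.germ k t"
        by (auto elim!: X.germ_cases)
      obtain l where l: "(j, l) \<in> r" "(k, l) \<in> r" using X.upper_bound j k by metis
      then have lJ: "l \<in> J" using X.le_carrier by blast
      interpret Fl: group "fobj (F l) X" by (rule X.groups[OF lJ])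
      define u where "u = \<tau> j l X s"
      define v where "v = \<tau> k l X t"
      have u: "u \<in> carrier (fobj (F l) X)" and v: "v \<in> carrier (fobj (F l) X)"
        using X.phi_closed l j k by (auto simp: u_def v_def)
      have uv: "\<sigma> l X u = \<sigma> l X v"
        using eq j k by (simp add: u_def v_def C(2)[OF l(1) X] C(2)[OF l(2) X] \<theta>_germ[OF X])
      interpret \<sigma>l: group_hom "fobj (F l) X" "fobj M X" "\<sigma> l X"
        by unfold_locales (rule nat_transD(1)[OF C(1)[OF lJ] X])
      have "\<sigma> l X (u \<otimes>\<^bsub>fobj (F l) X\<^esub> inv\<^bsub>fobj (F l) X\<^esub> v) = \<one>\<^bsub>fobj M X\<^esub>"
        using u v uv by simp
      then obtain m where m: "(l, m) \<in> r"
        "\<tau> l m X (u \<otimes>\<^bsub>fobj (F l) X\<^esub> inv\<^bsub>fobj (F l) X\<^esub> v) = \<one>\<^bsub>fobj (F m) X\<^esub>"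
        using C(4)[OF X lJ] u v by (meson Fl.inv_closed Fl.m_closed)
      interpret Fm: group "fobj (F m) X" using X.groups X.le_carrier m by blast
      interpret lm: group_hom "fobj (F l) X" "fobj (F m) X" "\<tau> l m X"
        by unfold_locales (rule X.hom[OF m(1)])
      have "\<tau> l m X u = \<tau> l m X v"
        using m(2) u v by (simp add: Fm.inv_solve_right')
      then have "X.germ l u = X.germ l v"
        using m u v by (intro X.germ_eqI[of l m l]) auto
      then show "A = B"
        using j k l by (simp add: u_def v_def X.germ_phi)
    qed
    moreover have "\<theta> X ` carrier X.L = carrier (fobj M X)"
    proof
      show "\<theta> X ` carrier X.L \<subseteq> carrier (fobj M X)"
        using hom by (auto simp: hom_def)
      show "carrier (fobj M X) \<subseteq> \<theta> X ` carrier X.L"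
      proof
        fix t assume "t \<in> carrier (fobj M X)"
        then obtain j s where "j \<in> J" "s \<in> carrier (fobj (F j) X)" "t = \<sigma> j X s"
          using C(3)[OF X] by blast
        then show "t \<in> \<theta> X ` carrier X.L"
          by (intro image_eqI[of _ _ "X.germ j s"]) (simp_all add: \<theta>_germ[OF X] X.germ_closed)
      qed
    qed
    ultimately show "\<theta> X \<in> iso (fobj (direct_limit J r F \<tau>) X) (fobj M X)"
      using hom by (simp add: iso_def bij_betw_def)
  next
    fix X Y f A assume X: "X \<in> Rmod \<kappa> R" and Y: "Y \<in> Rmod \<kappa> R" and f: "f \<in> Rhom R X Y"
      and "A \<in> carrier (fobj (direct_limit J r F \<tau>) X)"
    then obtain j s where j: "j \<in> J" and s: "s \<in> carrier (fobj (F j) X)"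
      and A: "A = germ_rel J r (\<lambda>j. fobj (F j) X) (\<lambda>j k. \<tau> j k X) `` {(j, s)}"
      using group_system.germ_cases[OF gs[OF X]] by (metis fobj_direct_limit)
    show "\<theta> Y (fmor (direct_limit J r F \<tau>) X Y f A) = fmor M X Y f (\<theta> X A)"
      using nat_transD(3)[OF C(1)[OF j] X Y f s]
        scriptR_module_closed[OF direct_systemD(2)[OF sys j] X Y f s]
      by (simp add: A fmor_direct_limit_germ[OF sys X Y f j s] \<theta>_germ X Y j s)
  qed
  then show ?thesis by blast
qed

section \<open>Left exactness of module schemes and of their direct limits\<close>

lemma Rhom_group_simps [simp]:
  "carrier (Rhom_group R N X) = Rhom R N X"
  "f \<otimes>\<^bsub>Rhom_group R N X\<^esub> g = (\<lambda>x \<in> carrier N. f x \<oplus>\<^bsub>X\<^esub> g x)"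
  "\<one>\<^bsub>Rhom_group R N X\<^esub> = (\<lambda>x \<in> carrier N. \<zero>\<^bsub>X\<^esub>)"
  by (simp_all add: Rhom_group_def)

lemma module_scheme_simps [simp]:
  "fobj (module_scheme R N) X = Rhom_group R N X"
  "fmor (module_scheme R N) X Y f h = compose (carrier N) f h"
  by (simp_all add: module_scheme_def)

lemma Rhom_zero_map:
  assumes "left_module R N" "left_module R X"
  shows "(\<lambda>x \<in> carrier N. \<zero>\<^bsub>X\<^esub>) \<in> Rhom R N X"
proof -
  interpret N: left_module R N by fact
  interpret X: left_module R X by fact
  show ?thesis by (rule RhomI) (auto simp: N.smult_closed X.smult_r_zero)
qed

lemma compose_zero_map:
  assumes "left_module R X" "left_module R Y" "f \<in> Rhom R X Y"
  shows "compose (carrier N) f (\<lambda>x \<in> carrier N. \<zero>\<^bsub>X\<^esub>) = (\<lambda>x \<in> carrier N. \<zero>\<^bsub>Y\<^esub>)"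
  using Rhom_zero[OF assms] by (auto simp: compose_def)

lemma comm_group_Rhom_group:
  assumes "left_module R N" "left_module R X"
  shows "comm_group (Rhom_group R N X)"
proof -
  interpret N: left_module R N by fact
  interpret X: left_module R X by fact
  note cl = Rhom_closed Rhom_add Rhom_smult
  show ?thesis
  proof (rule comm_groupI)
    show "f \<otimes>\<^bsub>Rhom_group R N X\<^esub> g \<in> carrier (Rhom_group R N X)"
      if "f \<in> carrier (Rhom_group R N X)" "g \<in> carrier (Rhom_group R N X)" for f g
      using that
      by (auto intro!: RhomI simp: N.smult_closed cl[of f] cl[of g] X.N.a_ac X.smult_r_distr)
    show "\<one>\<^bsub>Rhom_group R N X\<^esub> \<in> carrier (Rhom_group R N X)"
      using Rhom_zero_map[OF assms] by simp
    show "f \<otimes>\<^bsub>Rhom_group R N X\<^esub> g \<otimes>\<^bsub>Rhom_group R N X\<^esub> h =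
        f \<otimes>\<^bsub>Rhom_group R N X\<^esub> (g \<otimes>\<^bsub>Rhom_group R N X\<^esub> h)"
      if "f \<in> carrier (Rhom_group R N X)" "g \<in> carrier (Rhom_group R N X)"
        "h \<in> carrier (Rhom_group R N X)" for f g h
      using that by (auto simp: Rhom_closed X.N.a_assoc intro!: restrict_ext)
    show "f \<otimes>\<^bsub>Rhom_group R N X\<^esub> g = g \<otimes>\<^bsub>Rhom_group R N X\<^esub> f"
      if "f \<in> carrier (Rhom_group R N X)" "g \<in> carrier (Rhom_group R N X)" for f g
      using that by (auto simp: Rhom_closed X.N.a_comm intro!: restrict_ext)
    show "\<one>\<^bsub>Rhom_group R N X\<^esub> \<otimes>\<^bsub>Rhom_group R N X\<^esub> f = f"
      if "f \<in> carrier (Rhom_group R N X)" for f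
    proof -
      have "restrict (\<lambda>x. \<zero>\<^bsub>X\<^esub> \<oplus>\<^bsub>X\<^esub> f x) (carrier N) = restrict f (carrier N)"
        using that by (intro restrict_ext) (simp add: Rhom_closed)
      also have "\<dots> = f" using that by (auto dest!: Rhom_PiE simp: PiE_restrict)
      finally show ?thesis by (simp cong: restrict_cong)
    qed
    show "\<exists>g\<in>carrier (Rhom_group R N X). g \<otimes>\<^bsub>Rhom_group R N X\<^esub> f = \<one>\<^bsub>Rhom_group R N X\<^esub>"
      if f: "f \<in> carrier (Rhom_group R N X)" for f
    proof (rule bexI)
      let ?g = "\<lambda>x \<in> carrier N. (\<ominus>\<^bsub>R\<^esub> \<one>\<^bsub>R\<^esub>) \<odot>\<^bsub>X\<^esub> f x"
      have neg: "(\<ominus>\<^bsub>R\<^esub> \<one>\<^bsub>R\<^esub>) \<odot>\<^bsub>X\<^esub> y = \<ominus>\<^bsub>X\<^esub> y" if "y \<in> carrier X" for y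
        using X.minus_eq_smult[OF that] by simp
      have smult_neg: "a \<odot>\<^bsub>X\<^esub> (\<ominus>\<^bsub>X\<^esub> y) = \<ominus>\<^bsub>X\<^esub> (a \<odot>\<^bsub>X\<^esub> y)"
        if "a \<in> carrier R" "y \<in> carrier X" for a y
      proof (rule X.N.minus_equality[symmetric])
        have "a \<odot>\<^bsub>X\<^esub> (\<ominus>\<^bsub>X\<^esub> y) \<oplus>\<^bsub>X\<^esub> a \<odot>\<^bsub>X\<^esub> y = a \<odot>\<^bsub>X\<^esub> (\<ominus>\<^bsub>X\<^esub> y \<oplus>\<^bsub>X\<^esub> y)"
          using that by (simp only: X.smult_r_distr X.N.a_inv_closed)
        then show "a \<odot>\<^bsub>X\<^esub> (\<ominus>\<^bsub>X\<^esub> y) \<oplus>\<^bsub>X\<^esub> a \<odot>\<^bsub>X\<^esub> y = \<zero>\<^bsub>X\<^esub>"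
          using that by (simp add: X.N.l_neg X.smult_r_zero)
      qed (use that X.smult_closed in auto)
      show "?g \<in> carrier (Rhom_group R N X)"
        using f
        by (auto intro!: RhomI simp: neg N.smult_closed X.smult_closed Rhom_closed Rhom_add
            Rhom_smult X.N.minus_add X.N.a_comm smult_neg)
      show "?g \<otimes>\<^bsub>Rhom_group R N X\<^esub> f = \<one>\<^bsub>Rhom_group R N X\<^esub>"
        using f by (auto simp: neg Rhom_closed X.N.l_neg intro!: restrict_ext)
    qed
  qed
qed

lemma scriptR_module_module_scheme:
  fixes N :: "('r, 'u) module"
  assumes "N \<in> Rmod \<kappa> R"
  shows "scriptR_module \<kappa> R (module_scheme R N)"
proof -
  have N: "left_module R N" using assms by (rule Rmod_left_module)
  show ?thesis
  proof (rule scriptR_module.intro)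
    fix X :: "('r, 'u) module" assume X: "X \<in> Rmod \<kappa> R"
    show "comm_group (fobj (module_scheme R N) X)"
      using comm_group_Rhom_group[OF N Rmod_left_module[OF X]] by simp
    fix s assume "s \<in> carrier (fobj (module_scheme R N) X)"
    then show "fmor (module_scheme R N) X X (\<lambda>x\<in>carrier X. x) s = s"
      by (simp add: compose_Rhom_id)
  next
    fix X Y :: "('r, 'u) module" and f assume "X \<in> Rmod \<kappa> R" and "Y \<in> Rmod \<kappa> R" and f: "f \<in> Rhom R X Y"
    show "fmor (module_scheme R N) X Y f \<in> hom (fobj (module_scheme R N) X) (fobj (module_scheme R N) Y)"
      using Rhom_compose[OF N _ f] by (auto intro!: homI simp: compose_def Rhom_closed Rhom_add[OF f])
  next
    fix X Y Z :: "('r, 'u) module" and f g s assume "s \<in> carrier (fobj (module_scheme R N) X)"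
    then show "fmor (module_scheme R N) X Z (compose (carrier X) g f) s =
        fmor (module_scheme R N) Y Z g (fmor (module_scheme R N) X Y f s)"
      by (simp add: compose_Rhom_assoc)
  next
    fix X Y :: "('r, 'u) module" and f g s assume "s \<in> carrier (fobj (module_scheme R N) X)"
    then show "fmor (module_scheme R N) X Y (f \<otimes>\<^bsub>Rhom_group R X Y\<^esub> g) s =
        fmor (module_scheme R N) X Y f s \<otimes>\<^bsub>fobj (module_scheme R N) Y\<^esub> fmor (module_scheme R N) X Y g s"
      by (auto simp: compose_def Rhom_closed)
  qed
qed

lemma fmor_one:
  assumes "scriptR_module \<kappa> R M" "X \<in> Rmod \<kappa> R" "Y \<in> Rmod \<kappa> R" "f \<in> Rhom R X Y"
  shows "fmor M X Y f \<one>\<^bsub>fobj M X\<^esub> = \<one>\<^bsub>fobj M Y\<^esub>"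
  using assms by (intro hom_one[OF scriptR_module.mor[OF assms]]) (auto intro: scriptR_module_group)

text \<open>
Additivity makes the image of the zero map an idempotent, hence the unit.
\<close>

lemma fmor_zero_map:
  assumes M: "scriptR_module \<kappa> R M" and X: "X \<in> Rmod \<kappa> R" and Y: "Y \<in> Rmod \<kappa> R"
    and s: "s \<in> carrier (fobj M X)"
  shows "fmor M X Y (\<lambda>x \<in> carrier X. \<zero>\<^bsub>Y\<^esub>) s = \<one>\<^bsub>fobj M Y\<^esub>"
proof -
  let ?z = "\<one>\<^bsub>Rhom_group R X Y\<^esub>"
  interpret XY: comm_group "Rhom_group R X Y"
    by (rule comm_group_Rhom_group[OF Rmod_left_module[OF X] Rmod_left_module[OF Y]])
  interpret MY: group "fobj M Y" by (rule scriptR_module_group[OF M Y])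
  have z: "?z \<in> Rhom R X Y" using XY.one_closed by simp
  have "fmor M X Y (?z \<otimes>\<^bsub>Rhom_group R X Y\<^esub> ?z) s = fmor M X Y ?z s \<otimes>\<^bsub>fobj M Y\<^esub> fmor M X Y ?z s"
    by (rule scriptR_module.additive[OF M X Y z z s])
  moreover have "?z \<otimes>\<^bsub>Rhom_group R X Y\<^esub> ?z = ?z"
    by (rule XY.l_one[OF XY.one_closed])
  moreover have "fmor M X Y ?z s \<in> carrier (fobj M Y)"
    by (rule scriptR_module_closed[OF M X Y z s])
  ultimately have "fmor M X Y ?z s = \<one>\<^bsub>fobj M Y\<^esub>"
    using MY.l_cancel_one' by metis
  then show ?thesis by simp
qed

lemma left_exactD:
  assumes "left_exact \<kappa> R F" "A \<in> Rmod \<kappa> R" "B \<in> Rmod \<kappa> R" "C \<in> Rmod \<kappa> R"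
    and "f \<in> Rhom R A B" "g \<in> Rhom R B C" "inj_on f (carrier A)" "f ` carrier A = a_kernel B C g"
  shows "inj_on (fmor F A B f) (carrier (fobj F A))"
    and "fmor F A B f ` carrier (fobj F A) = kernel (fobj F B) (fobj F C) (fmor F B C g)"
  using assms unfolding left_exact_def by blast+

lemma Rhom_factor_injective:
  assumes N: "left_module R N" and A: "left_module R A" and f: "f \<in> Rhom R A B"
    and inj: "inj_on f (carrier A)" and h: "h \<in> Rhom R N B" and im: "h ` carrier N \<subseteq> f ` carrier A"
  obtains h' where "h' \<in> Rhom R N A" "compose (carrier N) f h' = h"
proof -
  interpret N: left_module R N by fact
  interpret A: left_module R A by fact
  define h' where "h' = (\<lambda>x \<in> carrier N. inv_into (carrier A) f (h x))"
  have cl: "h' x \<in> carrier A" and fh': "f (h' x) = h x" if "x \<in> carrier N" for x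
    using that im by (auto simp: h'_def inv_into_into f_inv_into_f image_subset_iff)
  have "h' \<in> Rhom R N A"
  proof (rule RhomI)
    show "h' \<in> carrier N \<rightarrow>\<^sub>E carrier A" using cl by (auto simp: h'_def)
  next
    fix x y assume x: "x \<in> carrier N" and y: "y \<in> carrier N"
    show "h' (x \<oplus>\<^bsub>N\<^esub> y) = h' x \<oplus>\<^bsub>A\<^esub> h' y"
      by (rule inj_onD[OF inj]) (simp_all add: x y cl fh' Rhom_add[OF f] Rhom_add[OF h])
  next
    fix a x assume a: "a \<in> carrier R" and x: "x \<in> carrier N"
    show "h' (a \<odot>\<^bsub>N\<^esub> x) = a \<odot>\<^bsub>A\<^esub> h' x"
      by (rule inj_onD[OF inj])
        (simp_all add: a x cl fh' Rhom_smult[OF f] Rhom_smult[OF h] N.smult_closed A.smult_closed)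
  qed
  moreover have "compose (carrier N) f h' = h"
    using fh' Rhom_PiE[OF h] by (auto simp: compose_def fun_eq_iff PiE_def extensional_def)
  ultimately show ?thesis by (rule that)
qed

text \<open>
A map into \<open>B\<close> is killed by \<open>g\<close> iff its values lie in the kernel of \<open>g\<close>, which is the image of the
injective map \<open>f\<close>; it then factors through \<open>f\<close>.
\<close>

lemma left_exact_module_scheme:
  fixes N :: "('r, 'u) module"
  assumes "N \<in> Rmod \<kappa> R"
  shows "left_exact \<kappa> R (module_scheme R N)"
  unfolding left_exact_def
proof (intro ballI impI)
  have N: "left_module R N" using assms by (rule Rmod_left_module)
  fix A B C :: "('r, 'u) module" and f g
  assume A: "A \<in> Rmod \<kappa> R" and f: "f \<in> Rhom R A B" and g: "g \<in> Rhom R B C"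
    and ex: "inj_on f (carrier A) \<and> f ` carrier A = a_kernel B C g"
  have "inj_on (compose (carrier N) f) (Rhom R N A)"
  proof (rule inj_onI)
    fix h k assume h: "h \<in> Rhom R N A" and k: "k \<in> Rhom R N A"
      and eq: "compose (carrier N) f h = compose (carrier N) f k"
    show "h = k"
    proof (rule Rhom_eqI[OF h k])
      fix x assume x: "x \<in> carrier N"
      have "f (h x) = f (k x)" using fun_cong[OF eq, of x] x by (simp add: compose_def)
      with ex x h k show "h x = k x" by (meson Rhom_closed inj_onD)
    qed
  qed
  moreover have "compose (carrier N) f ` Rhom R N A =
      {h \<in> Rhom R N B. compose (carrier N) g h = (\<lambda>x \<in> carrier N. \<zero>\<^bsub>C\<^esub>)}"
  proof (intro equalityI subsetI)
    fix h assume "h \<in> compose (carrier N) f ` Rhom R N A"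
    then obtain k where k: "k \<in> Rhom R N A" "h = compose (carrier N) f k" by blast
    have "g (f (k x)) = \<zero>\<^bsub>C\<^esub>" if "x \<in> carrier N" for x
      using ex Rhom_closed[OF k(1) that] by (auto simp: a_kernel_def')
    then show "h \<in> {h \<in> Rhom R N B. compose (carrier N) g h = (\<lambda>x \<in> carrier N. \<zero>\<^bsub>C\<^esub>)}"
      using k Rhom_compose[OF N k(1) f] by (auto simp: compose_def intro!: restrict_ext)
  next
    fix h assume "h \<in> {h \<in> Rhom R N B. compose (carrier N) g h = (\<lambda>x \<in> carrier N. \<zero>\<^bsub>C\<^esub>)}"
    then have h: "h \<in> Rhom R N B" and gh: "compose (carrier N) g h = (\<lambda>x \<in> carrier N. \<zero>\<^bsub>C\<^esub>)" by auto
    have "h x \<in> f ` carrier A" if "x \<in> carrier N" for x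
      using fun_cong[OF gh, of x] that Rhom_closed[OF h that] ex
      by (auto simp: compose_def a_kernel_def')
    then have "h ` carrier N \<subseteq> f ` carrier A" by blast
    from Rhom_factor_injective[OF N Rmod_left_module[OF A] f _ h this] ex
    show "h \<in> compose (carrier N) f ` Rhom R N A" by (metis image_eqI)
  qed
  ultimately show "inj_on (fmor (module_scheme R N) A B f) (carrier (fobj (module_scheme R N) A)) \<and>
      fmor (module_scheme R N) A B f ` carrier (fobj (module_scheme R N) A) =
      kernel (fobj (module_scheme R N) B) (fobj (module_scheme R N) C) (fmor (module_scheme R N) B C g)"
    by (simp add: kernel_def inj_on_def)
qed

text \<open>
Directed limits are exact: an element of \<open>M\<close> comes from some stage, an equation that it satisfies in
\<open>M\<close> holds at a later stage, left exactness of that stage solves the equation there, and the solution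
is pushed forward to \<open>M\<close>.
\<close>

lemma left_exact_limit_cocone:
  fixes F :: "'j \<Rightarrow> ('r, 'u, 'a) rfunctor"
  assumes sys: "direct_system \<kappa> R J r F \<tau>" and M: "scriptR_module \<kappa> R M"
    and exact: "\<And>j. j \<in> J \<Longrightarrow> left_exact \<kappa> R (F j)"
    and cocone: "limit_cocone \<kappa> R J r F \<tau> M \<sigma>"
  shows "left_exact \<kappa> R M"
  unfolding left_exact_def
proof (intro ballI impI, elim conjE)
  note C = limit_coconeD[OF cocone]
  fix A B C :: "('r, 'u) module" and f g
  assume A: "A \<in> Rmod \<kappa> R" and B: "B \<in> Rmod \<kappa> R" and C': "C \<in> Rmod \<kappa> R"
    and f: "f \<in> Rhom R A B" and g: "g \<in> Rhom R B C"
    and ex: "inj_on f (carrier A)" "f ` carrier A = a_kernel B C g"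
  interpret MA: group "fobj M A" by (rule scriptR_module_group[OF M A])
  interpret MB: group "fobj M B" by (rule scriptR_module_group[OF M B])
  interpret Mf: group_hom "fobj M A" "fobj M B" "fmor M A B f"
    by unfold_locales (rule scriptR_module.mor[OF M A B f])
  have J: "k \<in> J" if "(j, k) \<in> r" for j k
    using direct_systemD(1)[OF sys] that by (auto simp: directed_on_def preorder_on_def)
  have \<sigma>_one: "\<sigma> j X \<one>\<^bsub>fobj (F j) X\<^esub> = \<one>\<^bsub>fobj M X\<^esub>" if "j \<in> J" "X \<in> Rmod \<kappa> R" for j X
    using that by (intro hom_one[OF nat_transD(1)[OF C(1)]] scriptR_module_group[OF M]
        scriptR_module_group[OF direct_systemD(2)[OF sys]])
  note exact' = left_exactD[OF exact A B C' f g ex]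
  have "t = \<one>\<^bsub>fobj M A\<^esub>" if t: "t \<in> carrier (fobj M A)" and ft: "fmor M A B f t = \<one>\<^bsub>fobj M B\<^esub>" for t
  proof -
    obtain j s where j: "j \<in> J" and s: "s \<in> carrier (fobj (F j) A)" and ts: "t = \<sigma> j A s"
      using C(3)[OF A t] by blast
    have fs: "fmor (F j) A B f s \<in> carrier (fobj (F j) B)"
      by (rule scriptR_module_closed[OF direct_systemD(2)[OF sys j] A B f s])
    have "\<sigma> j B (fmor (F j) A B f s) = \<one>\<^bsub>fobj M B\<^esub>"
      using nat_transD(3)[OF C(1)[OF j] A B f s] ft ts by simp
    from C(4)[OF B j fs this] obtain k where jk: "(j, k) \<in> r"
      and one: "\<tau> j k B (fmor (F j) A B f s) = \<one>\<^bsub>fobj (F k) B\<^esub>" by blast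
    have k: "k \<in> J" by (rule J[OF jk])
    note Fk = direct_systemD(2)[OF sys k]
    have "fmor (F k) A B f (\<tau> j k A s) = fmor (F k) A B f \<one>\<^bsub>fobj (F k) A\<^esub>"
      using nat_transD(3)[OF direct_systemD(3)[OF sys jk] A B f s] one fmor_one[OF Fk A B f] by simp
    moreover have "\<one>\<^bsub>fobj (F k) A\<^esub> \<in> carrier (fobj (F k) A)"
      using scriptR_module_group[OF Fk A] by (simp add: group.is_monoid)
    ultimately have "\<tau> j k A s = \<one>\<^bsub>fobj (F k) A\<^esub>"
      using exact'(1)[OF k] nat_transD(2)[OF direct_systemD(3)[OF sys jk] A s]
      by (meson inj_onD)
    then show ?thesis
      using C(2)[OF jk A s] \<sigma>_one[OF k A] by (simp add: ts)
  qed
  then have inj: "inj_on (fmor M A B f) (carrier (fobj M A))"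
    by (simp add: Mf.inj_on_one_iff)
  have "fmor M A B f ` carrier (fobj M A) = kernel (fobj M B) (fobj M C) (fmor M B C g)"
  proof (intro equalityI subsetI)
    fix t assume "t \<in> fmor M A B f ` carrier (fobj M A)"
    then obtain u where u: "u \<in> carrier (fobj M A)" "t = fmor M A B f u" by blast
    have "compose (carrier A) g f = (\<lambda>x \<in> carrier A. \<zero>\<^bsub>C\<^esub>)"
      using ex(2) by (auto simp: compose_def a_kernel_def' intro!: restrict_ext)
    then have "fmor M B C g t = \<one>\<^bsub>fobj M C\<^esub>"
      using scriptR_module.comp[OF M A B C' f g u(1)] fmor_zero_map[OF M A C' u(1)] u(2) by simp
    then show "t \<in> kernel (fobj M B) (fobj M C) (fmor M B C g)"
      using u by (simp add: kernel_def)
  next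
    fix t assume "t \<in> kernel (fobj M B) (fobj M C) (fmor M B C g)"
    then have t: "t \<in> carrier (fobj M B)" and gt: "fmor M B C g t = \<one>\<^bsub>fobj M C\<^esub>"
      by (auto simp: kernel_def)
    obtain j s where j: "j \<in> J" and s: "s \<in> carrier (fobj (F j) B)" and ts: "t = \<sigma> j B s"
      using C(3)[OF B t] by blast
    have gs: "fmor (F j) B C g s \<in> carrier (fobj (F j) C)"
      by (rule scriptR_module_closed[OF direct_systemD(2)[OF sys j] B C' g s])
    have "\<sigma> j C (fmor (F j) B C g s) = \<one>\<^bsub>fobj M C\<^esub>"
      using nat_transD(3)[OF C(1)[OF j] B C' g s] gt ts by simp
    from C(4)[OF C' j gs this] obtain k where jk: "(j, k) \<in> r"
      and one: "\<tau> j k C (fmor (F j) B C g s) = \<one>\<^bsub>fobj (F k) C\<^esub>" by blast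
    have k: "k \<in> J" by (rule J[OF jk])
    have "\<tau> j k B s \<in> kernel (fobj (F k) B) (fobj (F k) C) (fmor (F k) B C g)"
      using nat_transD(3)[OF direct_systemD(3)[OF sys jk] B C' g s] one
        nat_transD(2)[OF direct_systemD(3)[OF sys jk] B s] by (simp add: kernel_def)
    then obtain u where u: "u \<in> carrier (fobj (F k) A)" "\<tau> j k B s = fmor (F k) A B f u"
      using exact'(2)[OF k] by blast
    have "t = fmor M A B f (\<sigma> k A u)"
      using C(2)[OF jk B s] nat_transD(3)[OF C(1)[OF k] A B f u(1)] u(2) by (simp add: ts)
    then show "t \<in> fmor M A B f ` carrier (fobj M A)"
      using nat_transD(2)[OF C(1)[OF k] A u(1)] by blast
  qed
  with inj show "inj_on (fmor M A B f) (carrier (fobj M A)) \<and>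
      fmor M A B f ` carrier (fobj M A) = kernel (fobj M B) (fobj M C) (fmor M B C g)" by blast
qed

lemma left_exact_of_direct_limit:
  fixes M :: "('r, 'u, 'a) rfunctor"
  assumes M: "scriptR_module \<kappa> R M" and lim: "is_direct_limit_of_module_schemes \<kappa> R M"
  shows "left_exact \<kappa> R M"
proof -
  obtain J :: "'u set" and r \<tau> \<theta> and N :: "'u \<Rightarrow> ('r, 'u) module" where N: "\<forall>j\<in>J. N j \<in> Rmod \<kappa> R"
    and sys: "direct_system \<kappa> R J r (\<lambda>j. module_scheme R (N j)) \<tau>"
    and iso: "nat_iso \<kappa> R (direct_limit J r (\<lambda>j. module_scheme R (N j)) \<tau>) M \<theta>"
    using lim unfolding is_direct_limit_of_module_schemes_def by blast
  show ?thesis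
    by (rule left_exact_limit_cocone[OF sys M _ limit_cocone_of_nat_iso[OF sys M iso]])
      (use N left_exact_module_scheme in blast)
qed

section \<open>Elements supported on a submodule\<close>

text \<open>
\<open>M\<close> applied to a submodule \<open>H\<close> of \<open>N\<close> is not a subset of \<open>M\<close> applied to \<open>N\<close>; the elements
"supported on \<open>H\<close>" are therefore those in the image of the map induced by the inclusion.
\<close>

definition comes_from ::
    "('r, 'u, 'a) rfunctor \<Rightarrow> ('r, 'u) module \<Rightarrow> 'u set \<Rightarrow> 'a \<Rightarrow> bool" where
  "comes_from M N H s \<longleftrightarrow>
     s \<in> fmor M (N\<lparr>carrier := H\<rparr>) N (\<lambda>x \<in> H. x) ` carrier (fobj M (N\<lparr>carrier := H\<rparr>))"

text \<open>
An inclusion is the kernel of the projection onto the quotient.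
\<close>

lemma left_exact_inclusion_inj:
  assumes ex: "left_exact \<kappa> R M" and N: "N \<in> Rmod \<kappa> R" and H: "submodule H R N"
  shows "inj_on (fmor M (N\<lparr>carrier := H\<rparr>) N (\<lambda>x \<in> H. x)) (carrier (fobj M (N\<lparr>carrier := H\<rparr>)))"
proof -
  obtain Q q where Q: "Q \<in> Rmod \<kappa> R" "q \<in> Rhom R N Q" "a_kernel N Q q = H"
    using quotient_exists[OF N H] .
  show ?thesis
    by (rule left_exactD(1)[OF ex Rmod_restrict[OF N H] N Q(1)
          Rhom_inclusion[OF Rmod_left_module[OF N] H] Q(2)])
      (auto simp: Q(3) inj_on_def)
qed

lemma comes_from_a_kernel_iff:
  assumes ex: "left_exact \<kappa> R M" and N: "N \<in> Rmod \<kappa> R" and X: "X \<in> Rmod \<kappa> R" and g: "g \<in> Rhom R N X"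
  shows "comes_from M N (a_kernel N X g) s \<longleftrightarrow>
    s \<in> carrier (fobj M N) \<and> fmor M N X g s = \<one>\<^bsub>fobj M X\<^esub>"
proof -
  note H = submodule_a_kernel[OF Rmod_left_module[OF N] Rmod_left_module[OF X] g]
  have "fmor M (N\<lparr>carrier := a_kernel N X g\<rparr>) N (\<lambda>x \<in> a_kernel N X g. x) `
      carrier (fobj M (N\<lparr>carrier := a_kernel N X g\<rparr>)) =
    kernel (fobj M N) (fobj M X) (fmor M N X g)"
    by (rule left_exactD(2)[OF ex Rmod_restrict[OF N H] N X
          Rhom_inclusion[OF Rmod_left_module[OF N] H] g])
      (auto simp: inj_on_def)
  then show ?thesis by (simp add: comes_from_def kernel_def)
qed

lemma comes_from_carrier:
  assumes "scriptR_module \<kappa> R M" "N \<in> Rmod \<kappa> R" "s \<in> carrier (fobj M N)"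
  shows "comes_from M N (carrier N) s"
  using assms scriptR_module.ident[OF assms] by (auto simp: comes_from_def intro!: image_eqI[of _ _ s])

text \<open>
If \<open>H\<close> is the kernel of \<open>q\<close>, then its preimage is the kernel of \<open>q \<circ> f\<close>, and support on a kernel means
being killed by the map.
\<close>

lemma comes_from_preimage:
  assumes M: "scriptR_module \<kappa> R M" and ex: "left_exact \<kappa> R M"
    and A: "A \<in> Rmod \<kappa> R" and B: "B \<in> Rmod \<kappa> R" and f: "f \<in> Rhom R A B"
    and H: "submodule H R B" and s: "s \<in> carrier (fobj M A)" and fs: "comes_from M B H (fmor M A B f s)"
  shows "comes_from M A {x \<in> carrier A. f x \<in> H} s"
proof -
  obtain Q q where Q: "Q \<in> Rmod \<kappa> R" and q: "q \<in> Rhom R B Q" and ker: "a_kernel B Q q = H"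
    using quotient_exists[OF B H] .
  have qf: "compose (carrier A) q f \<in> Rhom R A Q"
    by (rule Rhom_compose[OF Rmod_left_module[OF A] f q])
  have "a_kernel A Q (compose (carrier A) q f) = {x \<in> carrier A. f x \<in> H}"
    using Rhom_closed[OF f] by (auto simp: a_kernel_def' compose_def simp flip: ker)
  moreover have "fmor M A Q (compose (carrier A) q f) s = \<one>\<^bsub>fobj M Q\<^esub>"
    using fs comes_from_a_kernel_iff[OF ex B Q q] scriptR_module.comp[OF M A B Q f q s]
    by (simp add: ker)
  ultimately show ?thesis
    using comes_from_a_kernel_iff[OF ex A Q qf] s by metis
qed

lemma comes_from_trans:
  assumes M: "scriptR_module \<kappa> R M" and N: "N \<in> Rmod \<kappa> R" and H: "submodule H R N"
    and K: "submodule K R (N\<lparr>carrier := H\<rparr>)" and t: "comes_from M (N\<lparr>carrier := H\<rparr>) K t"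
  shows "comes_from M N K (fmor M (N\<lparr>carrier := H\<rparr>) N (\<lambda>x \<in> H. x) t)"
proof -
  let ?H = "N\<lparr>carrier := H\<rparr>" and ?K = "N\<lparr>carrier := K\<rparr>"
  have KH: "K \<subseteq> H" using submoduleD(1)[OF K] by simp
  note N' = Rmod_left_module[OF N] and H' = Rmod_restrict[OF N H]
  have K': "?K \<in> Rmod \<kappa> R" using Rmod_restrict[OF H' K] by simp
  have iK: "(\<lambda>x \<in> K. x) \<in> Rhom R ?K ?H"
    using Rhom_inclusion[OF Rmod_left_module[OF H'] K] by simp
  have iH: "(\<lambda>x \<in> H. x) \<in> Rhom R ?H N" by (rule Rhom_inclusion[OF N' H])
  obtain u where u: "u \<in> carrier (fobj M ?K)" "t = fmor M ?K ?H (\<lambda>x \<in> K. x) u"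
    using t by (auto simp: comes_from_def)
  have "compose (carrier ?K) (\<lambda>x \<in> H. x) (\<lambda>x \<in> K. x) = (\<lambda>x \<in> K. x)"
    using KH by (auto simp: compose_def intro!: restrict_ext)
  then have "fmor M ?H N (\<lambda>x \<in> H. x) t = fmor M ?K N (\<lambda>x \<in> K. x) u"
    using scriptR_module.comp[OF M K' H' N iK iH u(1)] u(2) by simp
  with u(1) show ?thesis by (auto simp: comes_from_def)
qed

text \<open>
The element lifts to \<open>H\<close>, and \<open>H \<inter> K\<close> is the preimage of \<open>K\<close> under the inclusion of \<open>H\<close>.
\<close>

lemma comes_from_Int:
  assumes M: "scriptR_module \<kappa> R M" and ex: "left_exact \<kappa> R M" and N: "N \<in> Rmod \<kappa> R"
    and H: "submodule H R N" and K: "submodule K R N"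
    and sH: "comes_from M N H s" and sK: "comes_from M N K s"
  shows "comes_from M N (H \<inter> K) s"
proof -
  let ?H = "N\<lparr>carrier := H\<rparr>"
  note N' = Rmod_left_module[OF N] and H' = Rmod_restrict[OF N H]
  have iH: "(\<lambda>x \<in> H. x) \<in> Rhom R ?H N" by (rule Rhom_inclusion[OF N' H])
  obtain t where t: "t \<in> carrier (fobj M ?H)" and s: "s = fmor M ?H N (\<lambda>x \<in> H. x) t"
    using sH by (auto simp: comes_from_def)
  have eq: "{x \<in> carrier ?H. (\<lambda>x \<in> H. x) x \<in> K} = H \<inter> K" by auto
  have "comes_from M ?H (H \<inter> K) t"
    using comes_from_preimage[OF M ex H' N iH K t] sK unfolding eq s by blast
  moreover have "submodule (H \<inter> K) R ?H"
    using submodule_preimage[OF Rmod_left_module[OF H'] N' iH K] unfolding eq .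
  ultimately show ?thesis
    unfolding s by (rule comes_from_trans[OF M N H, rotated])
qed

section \<open>Directed systems of modules representing a functor\<close>

text \<open>
By Yoneda, a cocone from a direct system of module schemes to \<open>M\<close> is the same as an inverse system of
modules \<open>N j\<close> together with elements \<open>s j\<close> of \<open>M\<close> at \<open>N j\<close> that match under the transition maps. The last
two assumptions say, in these terms, that the cocone is a direct limit.
\<close>

locale representing_system =
  fixes \<kappa> :: "'k rel" and R :: "'r ring" and M :: "('r, 'u, 'a) rfunctor"
    and J :: "'j set" and r :: "'j rel" and N :: "'j \<Rightarrow> ('r, 'u) module"
    and p :: "'j \<Rightarrow> 'j \<Rightarrow> 'u \<Rightarrow> 'u" and s :: "'j \<Rightarrow> 'a"
  assumes is_module: "scriptR_module \<kappa> R M"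
    and directed: "directed_on J r"
    and modules: "j \<in> J \<Longrightarrow> N j \<in> Rmod \<kappa> R"
    and maps: "(j, k) \<in> r \<Longrightarrow> p j k \<in> Rhom R (N k) (N j)"
    and map_id: "j \<in> J \<Longrightarrow> p j j = (\<lambda>x \<in> carrier (N j). x)"
    and map_comp: "\<lbrakk>(j, k) \<in> r; (k, l) \<in> r\<rbrakk> \<Longrightarrow> compose (carrier (N l)) (p j k) (p k l) = p j l"
    and elem: "j \<in> J \<Longrightarrow> s j \<in> carrier (fobj M (N j))"
    and elem_map: "(j, k) \<in> r \<Longrightarrow> fmor M (N k) (N j) (p j k) (s k) = s j"
    and generate: "\<lbrakk>X \<in> Rmod \<kappa> R; t \<in> carrier (fobj M X)\<rbrakk> \<Longrightarrow>
      \<exists>j \<in> J. \<exists>h \<in> Rhom R (N j) X. t = fmor M (N j) X h (s j)"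
    and vanish: "\<lbrakk>X \<in> Rmod \<kappa> R; j \<in> J; h \<in> Rhom R (N j) X; fmor M (N j) X h (s j) = \<one>\<^bsub>fobj M X\<^esub>\<rbrakk> \<Longrightarrow>
      \<exists>k. (j, k) \<in> r \<and> compose (carrier (N k)) h (p j k) = (\<lambda>x \<in> carrier (N k). \<zero>\<^bsub>X\<^esub>)"
begin

lemma le_carrier: "(j, k) \<in> r \<Longrightarrow> j \<in> J" "(j, k) \<in> r \<Longrightarrow> k \<in> J"
  using directed by (auto simp: directed_on_def preorder_on_def)

abbreviation \<tau> where "\<tau> j k X h \<equiv> compose (carrier (N k)) h (p j k)"

lemma direct_system: "direct_system \<kappa> R J r (\<lambda>j. module_scheme R (N j)) (\<lambda>j k X h. \<tau> j k X h)"
  unfolding direct_system_def nat_trans_def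
proof (intro conjI ballI allI impI)
  show "directed_on J r" by (rule directed)
  show "scriptR_module \<kappa> R (module_scheme R (N j))" if "j \<in> J" for j
    by (rule scriptR_module_module_scheme[OF modules[OF that]])
next
  fix j k and X :: "('r, 'u) module" assume jk: "(j, k) \<in> r"
  note Nk = Rmod_left_module[OF modules[OF le_carrier(2)[OF jk]]]
  show "\<tau> j k X \<in> hom (fobj (module_scheme R (N j)) X) (fobj (module_scheme R (N k)) X)"
    using Rhom_compose[OF Nk maps[OF jk]] Rhom_closed[OF maps[OF jk]]
    by (auto intro!: homI simp: compose_def)
  fix Y f h assume "h \<in> carrier (fobj (module_scheme R (N j)) X)"
  show "\<tau> j k Y (fmor (module_scheme R (N j)) X Y f h) = fmor (module_scheme R (N k)) X Y f (\<tau> j k X h)"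
    by (simp add: compose_Rhom_assoc[OF maps[OF jk]])
next
  fix j and X :: "('r, 'u) module" and h
  assume j: "j \<in> J" and h: "h \<in> carrier (fobj (module_scheme R (N j)) X)"
  then show "\<tau> j j X h = h" by (simp add: map_id compose_Rhom_id)
next
  fix j k l and X :: "('r, 'u) module" and h :: "'u \<Rightarrow> 'u"
  assume jkl: "(j, k) \<in> r \<and> (k, l) \<in> r"
  then show "\<tau> k l X (\<tau> j k X h) = \<tau> j l X h"
    using compose_Rhom_assoc[OF maps, of k l h "p j k"] map_comp by simp
qed

lemma limit_cocone:
  "limit_cocone \<kappa> R J r (\<lambda>j. module_scheme R (N j)) (\<lambda>j k X h. \<tau> j k X h) M
     (\<lambda>j X h. fmor M (N j) X h (s j))"
  unfolding limit_cocone_def nat_trans_def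
proof (intro conjI ballI allI impI)
  fix j and X :: "('r, 'u) module" assume j: "j \<in> J" and X: "X \<in> Rmod \<kappa> R"
  note Nj = modules[OF j]
  show "(\<lambda>h. fmor M (N j) X h (s j)) \<in> hom (fobj (module_scheme R (N j)) X) (fobj M X)"
    using scriptR_module_closed[OF is_module Nj X _ elem[OF j]]
      scriptR_module.additive[OF is_module Nj X _ _ elem[OF j]]
    by (auto intro!: homI)
  fix Y :: "('r, 'u) module" and f h assume Y: "Y \<in> Rmod \<kappa> R" and f: "f \<in> Rhom R X Y"
    and h: "h \<in> carrier (fobj (module_scheme R (N j)) X)"
  show "fmor M (N j) Y (fmor (module_scheme R (N j)) X Y f h) (s j) = fmor M X Y f (fmor M (N j) X h (s j))"
    using scriptR_module.comp[OF is_module Nj X Y _ f elem[OF j]] h by simp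
next
  fix j k and X :: "('r, 'u) module" and h
  assume jk: "(j, k) \<in> r" and X: "X \<in> Rmod \<kappa> R" and h: "h \<in> carrier (fobj (module_scheme R (N j)) X)"
  then show "fmor M (N k) X (\<tau> j k X h) (s k) = fmor M (N j) X h (s j)"
    using scriptR_module.comp[OF is_module modules modules X maps[OF jk] _ elem] le_carrier[OF jk]
    by (simp add: elem_map)
qed (use generate vanish in auto)

lemma nat_iso_direct_limit:
  "\<exists>\<theta>. nat_iso \<kappa> R (direct_limit J r (\<lambda>j. module_scheme R (N j)) (\<lambda>j k X h. \<tau> j k X h)) M \<theta>"
  by (rule nat_iso_of_limit_cocone[OF direct_system is_module limit_cocone])

text \<open>
The index set is moved into another type, later the universe, along an injection.
\<close>

lemma reindex:
  assumes "inj_on c J"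
  defines "d \<equiv> inv_into J c"
  shows "representing_system \<kappa> R M (c ` J)
    {(a, b). a \<in> c ` J \<and> b \<in> c ` J \<and> (d a, d b) \<in> r} (\<lambda>j. N (d j)) (\<lambda>j k. p (d j) (d k)) (\<lambda>j. s (d j))"
proof -
  have dc: "d (c j) = j" if "j \<in> J" for j
    using that assms by simp
  have dJ: "d a \<in> J" if "a \<in> c ` J" for a
    using that by (simp add: d_def inv_into_into)
  let ?r = "{(a, b). a \<in> c ` J \<and> b \<in> c ` J \<and> (d a, d b) \<in> r}"
  show ?thesis
  proof (rule representing_system.intro)
    have r: "preorder_on J r" using directed by (simp add: directed_on_def)
    have "refl_on (c ` J) ?r"
      using r dJ by (auto simp: preorder_on_def refl_on_def)
    moreover have "trans ?r"
      using r by (auto simp: preorder_on_def intro!: transI dest: transD)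
    moreover have "\<exists>l\<in>c ` J. (a, l) \<in> ?r \<and> (b, l) \<in> ?r" if ab: "a \<in> c ` J" "b \<in> c ` J" for a b
    proof -
      obtain l where "l \<in> J" "(d a, l) \<in> r" "(d b, l) \<in> r"
        using directed dJ[OF ab(1)] dJ[OF ab(2)] by (auto simp: directed_on_def)
      then show ?thesis using ab dc[of l] by (intro bexI[of _ "c l"]) auto
    qed
    ultimately show "directed_on (c ` J) ?r"
      using directed unfolding directed_on_def preorder_on_def by blast
    show "\<exists>j\<in>c ` J. \<exists>h\<in>Rhom R (N (d j)) X. t = fmor M (N (d j)) X h (s (d j))"
      if "X \<in> Rmod \<kappa> R" "t \<in> carrier (fobj M X)" for X t
      using generate[OF that] dc by auto
    show "\<exists>k. (j, k) \<in> ?r \<and>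
        compose (carrier (N (d k))) h (p (d j) (d k)) = (\<lambda>x\<in>carrier (N (d k)). \<zero>\<^bsub>X\<^esub>)"
      if X: "X \<in> Rmod \<kappa> R" and j: "j \<in> c ` J" and h: "h \<in> Rhom R (N (d j)) X"
        "fmor M (N (d j)) X h (s (d j)) = \<one>\<^bsub>fobj M X\<^esub>" for X j h
    proof -
      obtain k where k: "(d j, k) \<in> r"
        "compose (carrier (N k)) h (p (d j) k) = (\<lambda>x\<in>carrier (N k). \<zero>\<^bsub>X\<^esub>)"
        using vanish[OF X dJ[OF j] h] by blast
      with j dc[OF le_carrier(2)[OF k(1)]] le_carrier(2)[OF k(1)] show ?thesis
        by (intro exI[of _ "c k"]) auto
    qed
  qed (use is_module dJ modules maps map_id map_comp elem elem_map in auto)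
qed

end

lemma is_direct_limit_of_representing_system:
  fixes M :: "('r, 'u, 'a) rfunctor"
  assumes sys: "representing_system \<kappa> R M J r N p s" and small: "|J| <o |UNIV :: 'u set|"
  shows "is_direct_limit_of_module_schemes \<kappa> R M"
proof -
  obtain c :: "_ \<Rightarrow> 'u" where c: "inj_on c J" using inj_into_universe[OF small] by blast
  interpret J: representing_system \<kappa> R M J r N p s by (rule sys)
  interpret U: representing_system \<kappa> R M "c ` J"
    "{(a, b). a \<in> c ` J \<and> b \<in> c ` J \<and> (inv_into J c a, inv_into J c b) \<in> r}" "\<lambda>j. N (inv_into J c j)"
    "\<lambda>j k. p (inv_into J c j) (inv_into J c k)" "\<lambda>j. s (inv_into J c j)"
    by (rule J.reindex[OF c])
  have "|c ` J| <o |UNIV :: 'u set|"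
    by (rule ordLeq_ordLess_trans[OF card_of_image small])
  moreover have "\<forall>j\<in>c ` J. N (inv_into J c j) \<in> Rmod \<kappa> R"
    using U.modules by blast
  ultimately show ?thesis
    unfolding is_direct_limit_of_module_schemes_def
    using U.direct_system
    by - (rule exE[OF U.nat_iso_direct_limit], intro exI conjI, assumption+)
qed

section \<open>Elements of direct sums of module schemes\<close>

text \<open>
The element of the direct sum with components \<open>h i\<close> for \<open>i\<close> in \<open>F\<close> and trivial components elsewhere.
For finite \<open>F\<close> these are all the elements of the direct sum.
\<close>

definition extend_zero ::
    "('i \<Rightarrow> ('r, 'u) module) \<Rightarrow> 'i set \<Rightarrow> 'i set \<Rightarrow> ('r, 'u) module \<Rightarrow> ('i \<Rightarrow> 'u \<Rightarrow> 'u) \<Rightarrow> 'i \<Rightarrow> 'u \<Rightarrow> 'u" where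
  "extend_zero W I F X h = (\<lambda>i \<in> I. if i \<in> F then h i else (\<lambda>x \<in> carrier (W i). \<zero>\<^bsub>X\<^esub>))"

lemma carrier_direct_sum_module_schemes:
  assumes "\<And>i. i \<in> I \<Longrightarrow> W i \<in> Rmod \<kappa> R" and X: "X \<in> Rmod \<kappa> R"
  shows "carrier (fobj (direct_sum I (\<lambda>i. module_scheme R (W i))) X) =
    {h \<in> \<Pi>\<^sub>E i\<in>I. Rhom R (W i) X. finite {i \<in> I. h i \<noteq> (\<lambda>x \<in> carrier (W i). \<zero>\<^bsub>X\<^esub>)}}"
proof -
  have "group (Rhom_group R (W i) X)" if "i \<in> I" for i
    using comm_group_Rhom_group[OF Rmod_left_module[OF assms(1)[OF that]] Rmod_left_module[OF X]]
    by (rule comm_group.axioms(2))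
  then show ?thesis by (simp add: direct_sum_def carrier_sum_group)
qed

lemma extend_zero_closed:
  assumes W: "\<And>i. i \<in> I \<Longrightarrow> W i \<in> Rmod \<kappa> R" and X: "X \<in> Rmod \<kappa> R" and F: "F \<in> Fpow I"
    and h: "\<And>i. i \<in> F \<Longrightarrow> h i \<in> Rhom R (W i) X"
  shows "extend_zero W I F X h \<in> carrier (fobj (direct_sum I (\<lambda>i. module_scheme R (W i))) X)"
proof -
  have "{i \<in> I. extend_zero W I F X h i \<noteq> (\<lambda>x \<in> carrier (W i). \<zero>\<^bsub>X\<^esub>)} \<subseteq> F"
    by (auto simp: extend_zero_def)
  then have "finite {i \<in> I. extend_zero W I F X h i \<noteq> (\<lambda>x \<in> carrier (W i). \<zero>\<^bsub>X\<^esub>)}"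
    using F by (auto simp: Fpow_def intro: finite_subset)
  moreover have "extend_zero W I F X h \<in> (\<Pi>\<^sub>E i\<in>I. Rhom R (W i) X)"
    using h Rhom_zero_map[OF Rmod_left_module[OF W] Rmod_left_module[OF X]]
    by (auto simp: extend_zero_def)
  ultimately show ?thesis by (simp add: carrier_direct_sum_module_schemes[OF W X])
qed

lemma extend_zero_cases:
  assumes W: "\<And>i. i \<in> I \<Longrightarrow> W i \<in> Rmod \<kappa> R" and X: "X \<in> Rmod \<kappa> R"
    and h: "h \<in> carrier (fobj (direct_sum I (\<lambda>i. module_scheme R (W i))) X)"
  obtains F where "F \<in> Fpow I" "\<And>i. i \<in> F \<Longrightarrow> h i \<in> Rhom R (W i) X" "h = extend_zero W I F X h"
proof
  let ?F = "{i \<in> I. h i \<noteq> (\<lambda>x \<in> carrier (W i). \<zero>\<^bsub>X\<^esub>)}"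
  have h': "h \<in> (\<Pi>\<^sub>E i\<in>I. Rhom R (W i) X)" "finite ?F"
    using h by (auto simp: carrier_direct_sum_module_schemes[OF W X])
  show "?F \<in> Fpow I" using h'(2) by (auto simp: Fpow_def)
  show "h i \<in> Rhom R (W i) X" if "i \<in> ?F" for i
    using h'(1) that by auto
  have "restrict h I = extend_zero W I ?F X h"
    unfolding extend_zero_def by (rule restrict_ext) auto
  then show "h = extend_zero W I ?F X h"
    using PiE_restrict[OF h'(1)] by simp
qed

lemma fmor_extend_zero:
  assumes "X \<in> Rmod \<kappa> R" "Y \<in> Rmod \<kappa> R" "f \<in> Rhom R X Y"
  shows "fmor (direct_sum I (\<lambda>i. module_scheme R (W i))) X Y f (extend_zero W I F X h) =
    extend_zero W I F Y (\<lambda>i. compose (carrier (W i)) f (h i))"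
  using compose_zero_map[OF Rmod_left_module[OF assms(1)] Rmod_left_module[OF assms(2)] assms(3)]
  by (auto simp: direct_sum_def extend_zero_def intro!: restrict_ext)

lemma extend_zero_cong:
  "(\<And>i. i \<in> I \<Longrightarrow> (if i \<in> F then h i else (\<lambda>x \<in> carrier (W i). \<zero>\<^bsub>X\<^esub>)) =
      (if i \<in> G then k i else (\<lambda>x \<in> carrier (W i). \<zero>\<^bsub>X\<^esub>))) \<Longrightarrow>
    extend_zero W I F X h = extend_zero W I G X k"
  unfolding extend_zero_def by (rule restrict_ext)

section \<open>Left exact quotients of direct sums of module schemes\<close>

text \<open>
For a finite set \<open>F\<close> of indices let \<open>P F\<close> be the direct sum of the \<open>W i\<close>, \<open>i \<in> F\<close>, and let \<open>u F\<close> be the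
element of \<open>M\<close> at \<open>P F\<close> that corresponds to the restriction of \<open>\<pi>\<close> to the summands in \<open>F\<close>. The index set
consists of the pairs \<open>(F, H)\<close> with \<open>H\<close> a submodule of \<open>P F\<close> on which \<open>u F\<close> is supported, and the
module at \<open>(F, H)\<close> is \<open>H\<close>. Enlarging \<open>F\<close> makes the schemes reach more of \<open>M\<close>; shrinking \<open>H\<close> imposes the
relations that hold in \<open>M\<close>.
\<close>

theorem direct_limit_of_left_exact:
  fixes M :: "('r, 'u, 'a) rfunctor" and W :: "'i \<Rightarrow> ('r, 'u) module"
  assumes size: "size_setting \<kappa> TYPE('u)" and R: "ring R" and M: "scriptR_module \<kappa> R M"
    and small: "|I| <o |UNIV :: 'u set|"
    and W: "\<And>i. i \<in> I \<Longrightarrow> W i \<in> Rmod \<kappa> R"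
    and epi: "nat_epi \<kappa> R (direct_sum I (\<lambda>i. module_scheme R (W i))) M \<pi>"
    and ex: "left_exact \<kappa> R M"
  shows "is_direct_limit_of_module_schemes \<kappa> R M"
proof -
  let ?S = "direct_sum I (\<lambda>i. module_scheme R (W i))"
  have nat: "nat_trans \<kappa> R ?S M \<pi>" using epi by (simp add: nat_epi_def)
  have surj: "\<pi> X ` carrier (fobj ?S X) = carrier (fobj M X)" if "X \<in> Rmod \<kappa> R" for X
    using epi that by (simp add: nat_epi_def epi_def)
  have "\<exists>P \<iota>. coproduct \<kappa> R F W P \<iota>" if "F \<in> Fpow I" for F
    using that W by (intro finite_coproduct_exists[OF size R]) (auto simp: Fpow_def)
  then obtain P \<iota> where coprod: "\<And>F. F \<in> Fpow I \<Longrightarrow> coproduct \<kappa> R F W (P F) (\<iota> F)"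
    by metis
  have P: "P F \<in> Rmod \<kappa> R" and P': "left_module R (P F)" if "F \<in> Fpow I" for F
    using coprod[OF that] by (auto simp: coproduct_def intro: Rmod_left_module)
  have W': "W i \<in> Rmod \<kappa> R" "left_module R (W i)" if "F \<in> Fpow I" "i \<in> F" for F i
    using that W by (auto simp: Fpow_def intro: Rmod_left_module)
  have \<iota>: "\<iota> F i \<in> Rhom R (W i) (P F)" if "F \<in> Fpow I" "i \<in> F" for F i
    using coprod[OF that(1)] that(2) by (auto simp: coproduct_def)
  note copair = coproduct_copair[OF coprod] and coprod_eqI = coproduct_eqI[OF coprod W'(2)]

  \<comment> \<open>The family of inclusions \<open>\<iota> F i\<close> is the identity of \<open>P F\<close> seen as an element of the direct sum;
    so \<open>u F\<close> represents \<open>\<pi>\<close> on the summands in \<open>F\<close>, and \<open>fmor_u\<close> is the Yoneda correspondence.\<close>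
  define u where "u F = \<pi> (P F) (extend_zero W I F (P F) (\<iota> F))" for F
  have ext_\<iota>: "extend_zero W I F (P F) (\<iota> F) \<in> carrier (fobj ?S (P F))" if "F \<in> Fpow I" for F
    using extend_zero_closed[OF W P[OF that] that \<iota>[OF that]] .
  have u: "u F \<in> carrier (fobj M (P F))" if "F \<in> Fpow I" for F
    using nat_transD(2)[OF nat P[OF that] ext_\<iota>[OF that]] by (simp add: u_def)
  have fmor_u: "fmor M (P F) X g (u F) = \<pi> X (extend_zero W I F X (\<lambda>i. compose (carrier (W i)) g (\<iota> F i)))"
    if "F \<in> Fpow I" "X \<in> Rmod \<kappa> R" "g \<in> Rhom R (P F) X" for F X g
    unfolding u_def nat_transD(3)[OF nat P[OF that(1)] that(2,3) ext_\<iota>[OF that(1)], symmetric]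
      fmor_extend_zero[OF P[OF that(1)] that(2,3)] ..

  \<comment> \<open>\<open>q F G\<close> is the projection of the sum over \<open>G\<close> that kills the summands outside \<open>F\<close>. All its
    properties follow by comparing composites with the inclusions.\<close>
  have "\<exists>q. q \<in> Rhom R (P G) (P F) \<and> (\<forall>i \<in> G. compose (carrier (W i)) q (\<iota> G i) =
      (if i \<in> F then \<iota> F i else (\<lambda>x \<in> carrier (W i). \<zero>\<^bsub>P F\<^esub>)))"
    if F: "F \<in> Fpow I" and G: "G \<in> Fpow I" for F G
  proof -
    have "(if i \<in> F then \<iota> F i else (\<lambda>x \<in> carrier (W i). \<zero>\<^bsub>P F\<^esub>)) \<in> Rhom R (W i) (P F)"
      if "i \<in> G" for i
      using \<iota>[OF F] Rhom_zero_map[OF W'(2)[OF G that] P'[OF F]] by simp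
    then show ?thesis by (rule copair[OF G P[OF F]])
  qed
  then obtain q where q: "\<And>F G. \<lbrakk>F \<in> Fpow I; G \<in> Fpow I\<rbrakk> \<Longrightarrow> q F G \<in> Rhom R (P G) (P F)"
    and q_\<iota>: "\<And>F G i. \<lbrakk>F \<in> Fpow I; G \<in> Fpow I; i \<in> G\<rbrakk> \<Longrightarrow> compose (carrier (W i)) (q F G) (\<iota> G i) =
      (if i \<in> F then \<iota> F i else (\<lambda>x \<in> carrier (W i). \<zero>\<^bsub>P F\<^esub>))"
    by metis
  have q_u: "fmor M (P G) (P F) (q F G) (u G) = u F"
    if F: "F \<in> Fpow I" and G: "G \<in> Fpow I" and FG: "F \<subseteq> G" for F G
  proof -
    have "extend_zero W I G (P F) (\<lambda>i. compose (carrier (W i)) (q F G) (\<iota> G i)) =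
        extend_zero W I F (P F) (\<iota> F)"
      using FG by (intro extend_zero_cong) (auto simp: q_\<iota>[OF F G])
    then show ?thesis by (simp add: fmor_u[OF G P[OF F] q[OF F G]]) (simp add: u_def)
  qed
  have q_id: "q F F = (\<lambda>x \<in> carrier (P F). x)" if F: "F \<in> Fpow I" for F
    using q_\<iota>[OF F F] compose_Rhom_id(2)[OF \<iota>[OF F]]
    by (intro coprod_eqI[OF F F _ P[OF F] q[OF F F] Rhom_id[OF P'[OF F]]]) simp_all
  have q_comp: "compose (carrier (P K)) (q F G) (q G K) = q F K"
    if F: "F \<in> Fpow I" and G: "G \<in> Fpow I" and K: "K \<in> Fpow I" and "F \<subseteq> G" for F G K
  proof (rule coprod_eqI[OF K K _ P[OF F] Rhom_compose[OF P'[OF K] q[OF G K] q[OF F G]] q[OF F K]])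
    fix i assume i: "i \<in> K"
    have "compose (carrier (W i)) (compose (carrier (P K)) (q F G) (q G K)) (\<iota> K i) =
        compose (carrier (W i)) (q F G) (compose (carrier (W i)) (q G K) (\<iota> K i))"
      by (rule compose_Rhom_assoc[OF \<iota>[OF K i], symmetric])
    also have "\<dots> = compose (carrier (W i)) (q F K) (\<iota> K i)"
      using \<open>F \<subseteq> G\<close> compose_zero_map[OF P'[OF G] P'[OF F] q[OF F G], of "W i"]
      by (auto simp: q_\<iota>[OF G K i] q_\<iota>[OF F K i] q_\<iota>[OF F G])
    finally show "compose (carrier (W i)) (compose (carrier (P K)) (q F G) (q G K)) (\<iota> K i) =
        compose (carrier (W i)) (q F K) (\<iota> K i)" .
  qed
  have q_apply: "q F G (q G K x) = q F K x"
    if "F \<in> Fpow I" "G \<in> Fpow I" "K \<in> Fpow I" "F \<subseteq> G" "x \<in> carrier (P K)" for F G K x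
    using fun_cong[OF q_comp[OF that(1-4)], of x] that(5) by (simp add: compose_def)

  \<comment> \<open>\<open>s (F, H)\<close> is the lift of \<open>u F\<close> to \<open>H\<close>, unique because \<open>M\<close> preserves the injection of \<open>H\<close>.\<close>
  define J where "J = {(F, H). F \<in> Fpow I \<and> submodule H R (P F) \<and> comes_from M (P F) H (u F)}"
  define r where "r = {((F, H), (G, K)). (F, H) \<in> J \<and> (G, K) \<in> J \<and> F \<subseteq> G \<and> q F G ` K \<subseteq> H}"
  define N where "N = (\<lambda>(F, H). (P F)\<lparr>carrier := H\<rparr>)"
  define p where "p = (\<lambda>(F, H :: 'u set) (G, K). restrict (q F G) K)"
  define s where "s = (\<lambda>(F, H). SOME t. t \<in> carrier (fobj M ((P F)\<lparr>carrier := H\<rparr>)) \<and>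
    fmor M ((P F)\<lparr>carrier := H\<rparr>) (P F) (\<lambda>x \<in> H. x) t = u F)"
  have J: "F \<in> Fpow I" "submodule H R (P F)" "comes_from M (P F) H (u F)" if "(F, H) \<in> J" for F H
    using that by (auto simp: J_def)
  have s: "s (F, H) \<in> carrier (fobj M ((P F)\<lparr>carrier := H\<rparr>))"
    "fmor M ((P F)\<lparr>carrier := H\<rparr>) (P F) (\<lambda>x \<in> H. x) (s (F, H)) = u F" if "(F, H) \<in> J" for F H
  proof -
    have "\<exists>t. t \<in> carrier (fobj M ((P F)\<lparr>carrier := H\<rparr>)) \<and>
        fmor M ((P F)\<lparr>carrier := H\<rparr>) (P F) (\<lambda>x \<in> H. x) t = u F"
      using J(3)[OF that] by (auto simp: comes_from_def)
    from someI_ex[OF this] show "s (F, H) \<in> carrier (fobj M ((P F)\<lparr>carrier := H\<rparr>))"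
      "fmor M ((P F)\<lparr>carrier := H\<rparr>) (P F) (\<lambda>x \<in> H. x) (s (F, H)) = u F"
      by (auto simp: s_def)
  qed
  have N: "N (F, H) \<in> Rmod \<kappa> R" and incl: "(\<lambda>x \<in> H. x) \<in> Rhom R (N (F, H)) (P F)"
    if "(F, H) \<in> J" for F H
    using Rmod_restrict[OF P[OF J(1)[OF that]] J(2)[OF that]]
      Rhom_inclusion[OF P'[OF J(1)[OF that]] J(2)[OF that]] by (auto simp: N_def)
  have full: "(F, carrier (P F)) \<in> J" if "F \<in> Fpow I" for F
    using that comes_from_carrier[OF M P[OF that] u[OF that]] submodule_carrier[OF P'[OF that]]
    by (simp add: J_def)
  have pullback: "submodule {x \<in> carrier (P G). q F G x \<in> H} R (P G) \<and>
      comes_from M (P G) {x \<in> carrier (P G). q F G x \<in> H} (u G)"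
    if FH: "(F, H) \<in> J" and G: "G \<in> Fpow I" and FG: "F \<subseteq> G" for F H G
    using submodule_preimage[OF P'[OF G] P'[OF J(1)[OF FH]] q[OF J(1)[OF FH] G] J(2)[OF FH]]
      comes_from_preimage[OF M ex P[OF G] P[OF J(1)[OF FH]] q[OF J(1)[OF FH] G] J(2)[OF FH] u[OF G]]
      q_u[OF J(1)[OF FH] G FG] J(3)[OF FH] by simp
  have directed: "directed_on J r"
    unfolding directed_on_def preorder_on_def
  proof (intro conjI ballI)
    show "r \<subseteq> J \<times> J" by (auto simp: r_def)
    have "q F F ` H \<subseteq> H" if "(F, H) \<in> J" for F H
      using q_id[OF J(1)[OF that]] submoduleD(1)[OF J(2)[OF that]] by auto
    then show "refl_on J r" by (auto simp: refl_on_def r_def)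
    show "trans r"
    proof (rule transI)
      fix a b c assume ab: "(a, b) \<in> r" and bc: "(b, c) \<in> r"
      obtain F H G K E L where abc: "a = (F, H)" "b = (G, K)" "c = (E, L)" by (metis surj_pair)
      have *: "(F, H) \<in> J" "(G, K) \<in> J" "(E, L) \<in> J" "F \<subseteq> G" "G \<subseteq> E" "q F G ` K \<subseteq> H" "q G E ` L \<subseteq> K"
        using ab bc by (auto simp: r_def abc)
      have "q F E x \<in> H" if "x \<in> L" for x
        using q_apply[OF J(1) J(1) J(1), OF *(1-4), of x] that *(6,7) submoduleD(1)[OF J(2)[OF *(3)]]
        by (metis image_subset_iff subsetD)
      then show "(a, c) \<in> r" using * by (auto simp: r_def abc)
    qed
    show "J \<noteq> {}" using full[of "{}"] by (auto simp: Fpow_def)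
    fix a b assume "a \<in> J" "b \<in> J"
    then obtain F H G K where ab: "a = (F, H)" "b = (G, K)" and FH: "(F, H) \<in> J" and GK: "(G, K) \<in> J"
      by (metis surj_pair)
    \<comment> \<open>An upper bound: both submodules are pulled back to the sum over \<open>F \<union> G\<close> and intersected.\<close>
    have FG: "F \<union> G \<in> Fpow I" using J(1)[OF FH] J(1)[OF GK] by (auto simp: Fpow_def)
    let ?H = "{x \<in> carrier (P (F \<union> G)). q F (F \<union> G) x \<in> H}"
      and ?K = "{x \<in> carrier (P (F \<union> G)). q G (F \<union> G) x \<in> K}"
    have H: "submodule ?H R (P (F \<union> G))" "comes_from M (P (F \<union> G)) ?H (u (F \<union> G))"
      using pullback[OF FH FG] by auto
    have K: "submodule ?K R (P (F \<union> G))" "comes_from M (P (F \<union> G)) ?K (u (F \<union> G))"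
      using pullback[OF GK FG] by auto
    have "(F \<union> G, ?H \<inter> ?K) \<in> J"
      using FG submodule_Int[OF P'[OF FG] H(1) K(1)]
        comes_from_Int[OF M ex P[OF FG] H(1) K(1) H(2) K(2)] unfolding J_def by blast
    then show "\<exists>l\<in>J. (a, l) \<in> r \<and> (b, l) \<in> r"
      using FH GK by (intro bexI[of _ "(F \<union> G, ?H \<inter> ?K)"]) (auto simp: r_def ab)
  qed
  have p: "restrict (q F G) K \<in> Rhom R (N (G, K)) (N (F, H))"
    if "(F, H) \<in> J" "(G, K) \<in> J" "q F G ` K \<subseteq> H" for F H G K
    using Rhom_restrict[OF q[OF J(1)[OF that(1)] J(1)[OF that(2)]] J(2)[OF that(2)] that(3)]
    by (simp add: N_def)
  have "representing_system \<kappa> R M J r N p s"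
  proof (rule representing_system.intro[OF M directed])
    show "N a \<in> Rmod \<kappa> R" if "a \<in> J" for a
      using that N by (cases a) auto
    show "p a b \<in> Rhom R (N b) (N a)" if "(a, b) \<in> r" for a b
      using that p by (auto simp: r_def p_def)
    show "p a a = (\<lambda>x \<in> carrier (N a). x)" if a: "a \<in> J" for a
    proof -
      obtain F H where FH: "a = (F, H)" by (cases a)
      then show ?thesis
        using a submoduleD(1)[OF J(2), of F H] q_id[OF J(1), of F H]
        by (auto simp: p_def N_def Int_absorb1)
    qed
    show "compose (carrier (N c)) (p a b) (p b c) = p a c" if ab: "(a, b) \<in> r" and bc: "(b, c) \<in> r" for a b c
    proof -
      obtain F H G K E L where abc: "a = (F, H)" "b = (G, K)" "c = (E, L)" by (metis surj_pair)
      have *: "(F, H) \<in> J" "(G, K) \<in> J" "(E, L) \<in> J" "F \<subseteq> G" "q G E ` L \<subseteq> K"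
        using ab bc by (auto simp: r_def abc)
      have "compose L (restrict (q F G) K) (restrict (q G E) L) = restrict (q F E) L"
        unfolding compose_def
      proof (rule restrict_ext)
        fix x assume x: "x \<in> L"
        then show "restrict (q F G) K (restrict (q G E) L x) = q F E x"
          using q_apply[OF J(1) J(1) J(1), OF *(1-4), of x] *(5) submoduleD(1)[OF J(2)[OF *(3)]]
          by auto
      qed
      then show ?thesis by (simp add: abc p_def N_def)
    qed
    show "s a \<in> carrier (fobj M (N a))" if "a \<in> J" for a
      using that s(1) by (cases a) (auto simp: N_def)
    show "fmor M (N b) (N a) (p a b) (s b) = s a" if ab: "(a, b) \<in> r" for a b
    proof -
      obtain F H G K where ab': "a = (F, H)" "b = (G, K)" by (metis surj_pair)
      have *: "(F, H) \<in> J" "(G, K) \<in> J" "F \<subseteq> G" "q F G ` K \<subseteq> H"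
        using ab by (auto simp: r_def ab')
      note FH = *(1) and GK = *(2)
      note F = J(1)[OF FH] and G = J(1)[OF GK]
      have sb: "s (G, K) \<in> carrier (fobj M (N (G, K)))" and sa: "s (F, H) \<in> carrier (fobj M (N (F, H)))"
        using s(1)[OF FH] s(1)[OF GK] by (auto simp: N_def)
      note p' = p[OF FH GK *(4)]
      \<comment> \<open>Both sides become \<open>u F\<close> in \<open>P F\<close>, and the inclusion of \<open>H\<close> induces an injection.\<close>
      have "fmor M (N (F, H)) (P F) (\<lambda>x \<in> H. x)
          (fmor M (N (G, K)) (N (F, H)) (restrict (q F G) K) (s (G, K))) =
          fmor M (N (G, K)) (P F) (compose K (\<lambda>x \<in> H. x) (restrict (q F G) K)) (s (G, K))"
        using scriptR_module.comp[OF M N[OF GK] N[OF FH] P[OF F] p' incl[OF FH] sb] by (simp add: N_def)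
      also have "compose K (\<lambda>x \<in> H. x) (restrict (q F G) K) = compose K (q F G) (\<lambda>x \<in> K. x)"
        using *(4) by (auto simp: compose_def intro!: restrict_ext)
      also have "fmor M (N (G, K)) (P F) (compose K (q F G) (\<lambda>x \<in> K. x)) (s (G, K)) =
          fmor M (P G) (P F) (q F G) (fmor M (N (G, K)) (P G) (\<lambda>x \<in> K. x) (s (G, K)))"
        using scriptR_module.comp[OF M N[OF GK] P[OF G] P[OF F] incl[OF GK] q[OF F G] sb] by (simp add: N_def)
      also have "\<dots> = u F"
        using s(2)[OF GK] q_u[OF F G *(3)] by (simp add: N_def)
      also have "\<dots> = fmor M (N (F, H)) (P F) (\<lambda>x \<in> H. x) (s (F, H))"
        using s(2)[OF FH] by (simp add: N_def)
      finally have eq: "fmor M (N (F, H)) (P F) (\<lambda>x \<in> H. x)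
          (fmor M (N (G, K)) (N (F, H)) (restrict (q F G) K) (s (G, K))) =
        fmor M (N (F, H)) (P F) (\<lambda>x \<in> H. x) (s (F, H))" .
      have inj: "inj_on (fmor M (N (F, H)) (P F) (\<lambda>x \<in> H. x)) (carrier (fobj M (N (F, H))))"
        using left_exact_inclusion_inj[OF ex P[OF F] J(2)[OF FH]] by (simp add: N_def)
      from inj_onD[OF inj eq scriptR_module_closed[OF M N[OF GK] N[OF FH] p' sb] sa]
      show ?thesis by (simp add: ab' p_def)
    qed
    show "\<exists>a\<in>J. \<exists>h\<in>Rhom R (N a) X. t = fmor M (N a) X h (s a)"
      if X: "X \<in> Rmod \<kappa> R" and t: "t \<in> carrier (fobj M X)" for X t
    proof -
      \<comment> \<open>A preimage of \<open>t\<close> has finite support \<open>F\<close>, and its components glue to a map out of \<open>P F\<close>.\<close>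
      obtain k where k: "k \<in> carrier (fobj ?S X)" "t = \<pi> X k"
        using surj[OF X] t by blast
      obtain F where F: "F \<in> Fpow I" "\<And>i. i \<in> F \<Longrightarrow> k i \<in> Rhom R (W i) X" "k = extend_zero W I F X k"
        using extend_zero_cases[OF W X k(1)] by blast
      obtain h where h: "h \<in> Rhom R (P F) X" "\<And>i. i \<in> F \<Longrightarrow> compose (carrier (W i)) h (\<iota> F i) = k i"
        using copair[OF F(1) X F(2)] by auto
      have "extend_zero W I F X (\<lambda>i. compose (carrier (W i)) h (\<iota> F i)) = k"
        using h(2) by (subst F(3), intro extend_zero_cong) auto
      then have "t = fmor M (P F) X h (u F)"
        using fmor_u[OF F(1) X h(1)] k(2) by simp
      moreover have "s (F, carrier (P F)) = u F" "N (F, carrier (P F)) = P F"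
        using s[OF full[OF F(1)]] scriptR_module.ident[OF M P[OF F(1)]] by (auto simp: N_def)
      ultimately show ?thesis
        using h(1) full[OF F(1)] by (intro bexI[of _ "(F, carrier (P F))"] bexI[of _ h]) auto
    qed
    show "\<exists>b. (a, b) \<in> r \<and> compose (carrier (N b)) h (p a b) = (\<lambda>x \<in> carrier (N b). \<zero>\<^bsub>X\<^esub>)"
      if X: "X \<in> Rmod \<kappa> R" and a: "a \<in> J" and h: "h \<in> Rhom R (N a) X"
        and one: "fmor M (N a) X h (s a) = \<one>\<^bsub>fobj M X\<^esub>" for X a h
    proof -
      obtain F H where FH: "a = (F, H)" by (cases a)
      then have aJ: "(F, H) \<in> J" using a by simp
      note F = J(1)[OF aJ]
      \<comment> \<open>As \<open>h\<close> kills \<open>s a\<close>, left exactness puts \<open>s a\<close> on the kernel of \<open>h\<close>; hence that kernel gives a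
        later index, at which \<open>h\<close> vanishes.\<close>
      let ?K = "a_kernel (N a) X h"
      have sa: "s a \<in> carrier (fobj M (N a))" using s(1)[OF aJ] by (simp add: FH N_def)
      have K: "submodule ?K R (N a)"
        using N[OF aJ] FH by (intro submodule_a_kernel[OF _ Rmod_left_module[OF X] h] Rmod_left_module) auto
      have KH: "?K \<subseteq> H" by (auto simp: a_kernel_def' FH N_def)
      have "comes_from M (N a) ?K (s a)"
        using comes_from_a_kernel_iff[OF ex _ X h] N[OF aJ] sa one FH by blast
      then have "comes_from M (P F) ?K (u F)"
        using comes_from_trans[OF M P[OF F] J(2)[OF aJ], of ?K "s a"] K s(2)[OF aJ]
        by (simp add: FH N_def)
      moreover have "submodule ?K R (P F)"
        using submoduleD[OF K] submoduleD(1)[OF J(2)[OF aJ]]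
        by (intro left_module.submoduleI[OF P'[OF F]]) (auto simp: FH N_def)
      ultimately have bJ: "(F, ?K) \<in> J" using F by (simp add: J_def)
      have sub: "?K \<subseteq> carrier (P F)" by (rule submoduleD(1)[OF J(2)[OF bJ]])
      then have q_K: "q F F x = x" if "x \<in> ?K" for x
        using that by (auto simp: q_id[OF F])
      have "(a, (F, ?K)) \<in> r"
        using aJ bJ q_K KH by (auto simp: r_def FH)
      moreover have "compose (carrier (N (F, ?K))) h (p a (F, ?K)) = (\<lambda>x \<in> carrier (N (F, ?K)). \<zero>\<^bsub>X\<^esub>)"
        using q_K by (auto simp: p_def FH N_def compose_def a_kernel_def' intro!: restrict_ext)
      ultimately show ?thesis by blast
    qed
  qed
  \<comment> \<open>There are few finite sets \<open>F\<close>, each \<open>P F\<close> has few subsets by the strong limit condition, and the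
    universe is regular.\<close>
  moreover have "|J| <o |UNIV :: 'u set|"
  proof -
    note inf = size_setting_Cinfinite_UNIV[OF size]
    have "|Pair F ` Pow (carrier (P F))| <o |UNIV :: 'u set|" if "F \<in> Fpow I" for F
    proof -
      have "|carrier (P F)| <o \<kappa>" using P[OF that] by (simp add: Rmod_def)
      then show ?thesis
        by (rule ordLeq_ordLess_trans[OF card_of_image size_settingD(3)[OF size]])
    qed
    then have "|\<Union>F \<in> Fpow I. Pair F ` Pow (carrier (P F))| <o |UNIV :: 'u set|"
      by (rule regularCard_UNION_bound[OF inf size_settingD(2)[OF size] card_finite_subsets_ordLess[OF inf small]])
    moreover have "J \<subseteq> (\<Union>F \<in> Fpow I. Pair F ` Pow (carrier (P F)))"
      by (auto simp: J_def dest: submoduleD(1))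
    ultimately show ?thesis by (rule ordLeq_ordLess_trans[OF card_of_mono1, rotated])
  qed
  ultimately show ?thesis by (rule is_direct_limit_of_representing_system)
qed

theorem theorem3p4:
  fixes \<kappa> :: "'k rel" and R :: "'r ring" and M :: "('r, 'u, 'a) rfunctor"
    and I :: "'i set" and W :: "'i \<Rightarrow> ('r, 'u) module"
  assumes "size_setting \<kappa> TYPE('u)"
    and "ring R" and "|carrier R| <o \<kappa>"
    and "scriptR_module \<kappa> R M"
    and "|I| <o |UNIV :: 'u set|"
    and "\<And>i. i \<in> I \<Longrightarrow> W i \<in> Rmod \<kappa> R"
    and "nat_epi \<kappa> R (direct_sum I (\<lambda>i. module_scheme R (W i))) M \<pi>"
  shows "left_exact \<kappa> R M \<longleftrightarrow> is_direct_limit_of_module_schemes \<kappa> R M"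
proof
  assume "left_exact \<kappa> R M"
  with assms show "is_direct_limit_of_module_schemes \<kappa> R M"
    by (intro direct_limit_of_left_exact)
next
  assume "is_direct_limit_of_module_schemes \<kappa> R M"
  then show "left_exact \<kappa> R M"
    by (rule left_exact_of_direct_limit[OF assms(4)])
qed

end
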